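(* Let $N\geq 2$ and $m\geq 3$ be integers. Consider the preferential attachment process with $N$ types in which each new vertex chooses $m$ neighbours and adopts a type chosen uniformly at random from those types present among its neighbours (started from a fixed finite typed graph $G_0$ in which each of the $N$ types has positive total degree). Then for each type $i\in\{1,\dots,N\}$, the proportion of vertices of $G_n$ that have type $i$ converges almost surely to $1/N$ as $n\to\infty$.
   Context: The process: each vertex has one of $N$ types $1,\dots,N$, fixed once assigned. Start from a fixed finite graph $G_0$ whose vertices have assigned types, such that each type has positive total degree in $G_0$. For each $n\ge 1$, given $G_{n-1}$, choose $m$ vertices of $G_{n-1}$ independently and with replacement, each with probability proportional to degree in $G_{n-1}$. Form $G_n$ by adding a new vertex joined by $m$ edges to the chosen vertices (with multiple edges if a vertex is chosen more than once). Given the chosen vertices, the type of the new vertex is uniformly distributed on the set of types that occur at least once among the chosen vertices (each type occurring is counted once, regardless of multiplicity). *)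

theory Defs
  imports "HOL-Probability.Probability" "HOL-Library.Uprod"
begin

text \<open>
  Finite typed multigraphs. The vertices are the numbers below \<open>length (types g)\<close>, in order of
  arrival, and \<open>types g ! v\<close> is the type of the vertex \<open>v\<close>.
\<close>

datatype tgraph = TGraph (types: "nat list") (edges: "nat uprod multiset")

definition verts :: "tgraph \<Rightarrow> nat set" where
  "verts g = {..<length (types g)}"

definition type_of :: "tgraph \<Rightarrow> nat \<Rightarrow> nat" where
  "type_of g v = types g ! v"

definition typed_graph :: "nat \<Rightarrow> tgraph \<Rightarrow> bool" where
  "typed_graph N g \<longleftrightarrow>
     (\<forall>v\<in>verts g. type_of g v \<in> {1..N}) \<and> (\<forall>e\<in>#edges g. set_uprod e \<subseteq> verts g)"

text \<open>A loop contributes two to the degree of its vertex, a multiple edge its multiplicity.\<close>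

definition degree :: "tgraph \<Rightarrow> nat \<Rightarrow> nat" where
  "degree g v = size {#e \<in># edges g. v \<in> set_uprod e#} + count (edges g) (Upair v v)"

definition total_degree :: "tgraph \<Rightarrow> nat" where
  "total_degree g = (\<Sum>v\<in>verts g. degree g v)"

definition type_degree :: "tgraph \<Rightarrow> nat \<Rightarrow> nat" where
  "type_degree g i = (\<Sum>v\<in>{v\<in>verts g. type_of g v = i}. degree g v)"

definition type_proportion :: "tgraph \<Rightarrow> nat \<Rightarrow> real" where
  "type_proportion g i = real (card {v\<in>verts g. type_of g v = i}) / real (card (verts g))"

text \<open>
  \<open>embed_pmf\<close> is only meaningful for functions with total mass one; the lemma below shows that this
  is the case as soon as the graph has positive total degree.
\<close>

definition degree_biased :: "tgraph \<Rightarrow> nat pmf" where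
  "degree_biased g =
     embed_pmf (\<lambda>v. if v \<in> verts g then real (degree g v) / real (total_degree g) else 0)"

lemma pmf_degree_biased:
  assumes "total_degree g > 0"
  shows "pmf (degree_biased g) v =
           (if v \<in> verts g then real (degree g v) / real (total_degree g) else 0)"
  unfolding degree_biased_def
proof (rule pmf_embed_pmf)
  let ?f = "\<lambda>v. if v \<in> verts g then real (degree g v) / real (total_degree g) else 0"
  show "?f v \<ge> 0" for v
    by simp
  have fin: "finite (verts g)"
    by (simp add: verts_def)
  have "(\<integral>\<^sup>+v. ennreal (?f v) \<partial>count_space UNIV) = (\<Sum>v\<in>verts g. ennreal (?f v))"
    by (rule nn_integral_count_space'[OF fin]) auto
  also have "\<dots> = ennreal (\<Sum>v\<in>verts g. ?f v)"
    by (rule sum_ennreal) auto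
  also have "(\<Sum>v\<in>verts g. ?f v) = (\<Sum>v\<in>verts g. real (degree g v)) / real (total_degree g)"
    by (simp add: sum_divide_distrib)
  also have "\<dots> = 1"
    using assms by (simp add: total_degree_def flip: of_nat_sum)
  finally show "(\<integral>\<^sup>+v. ennreal (?f v) \<partial>count_space UNIV) = 1"
    by simp
qed

text \<open>\<open>vs\<close> lists the chosen neighbours; one edge is added for each entry of the list.\<close>

definition add_vertex :: "tgraph \<Rightarrow> nat \<Rightarrow> nat list \<Rightarrow> tgraph" where
  "add_vertex g t vs =
     TGraph (types g @ [t]) (edges g + mset (map (Upair (length (types g))) vs))"

definition pa_step :: "nat \<Rightarrow> tgraph \<Rightarrow> tgraph pmf" where
  "pa_step m g = do {
     vs \<leftarrow> replicate_pmf m (degree_biased g);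
     t \<leftarrow> pmf_of_set (type_of g ` set vs);
     return_pmf (add_vertex g t vs)
   }"

text \<open>
  A realisation of the process on some probability space: the conditional law of
  \<open>G (Suc n)\<close> given the whole history \<open>G 0, \<dots>, G n\<close> is \<open>pa_step m\<close> of the current graph.
\<close>

locale pref_attachment = prob_space M
  for M :: "'a measure" and m :: nat and G0 :: tgraph and G :: "nat \<Rightarrow> 'a \<Rightarrow> tgraph" +
  assumes measurable_G: "\<And>n. G n \<in> measurable M (count_space UNIV)"
    and initial: "AE \<omega> in M. G 0 \<omega> = G0"
    and transition: "\<And>n h g. \<P>(\<omega> in M. \<forall>k\<le>n. G k \<omega> = h k) > 0 \<Longrightarrow>
          \<P>(\<omega> in M. G (Suc n) \<omega> = g \<bar> \<forall>k\<le>n. G k \<omega> = h k) = pmf (pa_step m (h n)) g"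

end

theory Submission
  imports Defs
begin

text \<open>
  Write \<open>D\<close> for the total degree, \<open>D j\<close> for the total degree of the vertices of type \<open>j\<close>,
  \<open>x j = D j / D\<close> for the share of type \<open>j\<close>, and \<open>p j\<close> for the conditional probability that the
  next vertex gets type \<open>j\<close>. The share \<open>x j\<close> has drift \<open>m * (p j - x j) / D\<close> up to lower order,
  and the point is that for \<open>m \<ge> 3\<close> choosing uniformly among the types present favours the rare
  types: \<open>(\<Sum>j. (p j - x j) / x j) \<ge> c * (\<Sum>j. (x j - 1 / N)\<^sup>2)\<close> with \<open>c > 0\<close> (lemma
  \<open>adopt_prob_drift\<close>). To see this, write \<open>m * (x i - p i)\<close> as a sum over \<open>j\<close> of antisymmetric
  terms \<open>F i j\<close>, the expectation of the difference of the numbers of occurrences of \<open>i\<close> and \<open>j\<close> in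
  the sample, divided by the number of types present, on the event that both occur. Exchanging the
  two types in the sample shows that \<open>F i j\<close> has the sign of \<open>x i - x j\<close>; the weights \<open>1 / x j\<close>
  decrease in \<open>x j\<close>, so all terms of the resulting double sum are nonnegative.

  The left-hand side of that inequality is, up to the factor \<open>m / D\<close>, the expected decrease of
  \<open>\<Sum>j. - ln (x j)\<close> to first order. Adding \<open>2 * m / D j\<close> to \<open>- ln (D j)\<close> absorbs the second-order
  error. A second term controls the numbers of vertices: if \<open>B i\<close> is the number of vertices of
  type \<open>i\<close>, then \<open>Z = D i - 2 * m * B i\<close> has increments bounded by \<open>m\<close> with mean
  \<open>m * (x i - p i)\<close>, whose square is at most a multiple of \<open>\<Sum>j. (x j - 1 / N)\<^sup>2\<close> (lemma
  \<open>adopt_prob_Lipschitz\<close>). Hence a suitable positive combination of both terms is a nonnegative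
  supermartingale \<open>V\<close> whose expected decrease in one step is at least
  \<open>a / D * ((\<Sum>j. (x j - 1 / N)\<^sup>2) + (Z / D)\<^sup>2)\<close> (lemma \<open>Lyapunov_decrement\<close>).

  The decrements are almost surely summable, while \<open>D\<close> grows linearly and the harmonic series
  diverges; so along some subsequence the shares tend to \<open>1 / N\<close> and \<open>Z / D\<close> tends to \<open>0\<close>, which
  forces \<open>V\<close> to come arbitrarily close to its lower bound \<open>0\<close>. A nonnegative supermartingale that
  does so tends to \<open>0\<close> almost surely. Consequently \<open>x i\<close> tends to \<open>1 / N\<close> and \<open>Z / D\<close> to \<open>0\<close> along
  the whole sequence, and therefore the proportion \<open>B i / (number of vertices)\<close> tends to \<open>1 / N\<close>.
  The term \<open>- ln (x j)\<close> also keeps the shares away from \<open>0\<close>, so no separate argument is needed at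
  the boundary.
\<close>

section \<open>Nonnegative supermartingales\<close>

lemma (in prob_space) supermartingale_summable_decrements:
  fixes U H :: "nat \<Rightarrow> 'a \<Rightarrow> real"
  assumes intU: "\<And>n. integrable M (U n)" and intH: "\<And>n. integrable M (H n)"
    and U0: "\<And>n \<omega>. \<omega> \<in> space M \<Longrightarrow> 0 \<le> U n \<omega>"
    and H0: "\<And>n \<omega>. \<omega> \<in> space M \<Longrightarrow> 0 \<le> H n \<omega>"
    and decr: "\<And>n. expectation (U (Suc n)) \<le> expectation (U n) - expectation (H n)"
  shows "AE \<omega> in M. summable (\<lambda>n. H n \<omega>)"
proof -
  have bound: "(\<Sum>k<n. expectation (H k)) \<le> expectation (U 0)" for n
  proof -
    have "(\<Sum>k<n. expectation (H k)) \<le> expectation (U 0) - expectation (U n)"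
    proof (induction n)
      case (Suc n)
      then show ?case using decr[of n] by simp
    qed simp
    moreover have "expectation (U n) \<ge> 0"
      by (intro integral_nonneg_AE AE_I2) (simp add: U0)
    ultimately show ?thesis by simp
  qed
  have "(\<integral>\<^sup>+\<omega>. (\<Sum>n. ennreal (H n \<omega>)) \<partial>M) = (\<Sum>n. \<integral>\<^sup>+\<omega>. ennreal (H n \<omega>) \<partial>M)"
    using intH by (intro nn_integral_suminf) auto
  also have "\<dots> = (\<Sum>n. ennreal (expectation (H n)))"
    by (intro suminf_cong nn_integral_eq_integral[OF intH] AE_I2) (simp add: H0)
  also have "\<dots> \<le> ennreal (expectation (U 0))"
  proof (rule suminf_le_const)
    show "(\<Sum>k<n. ennreal (expectation (H k))) \<le> ennreal (expectation (U 0))" for n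
      using bound[of n]
      by (subst sum_ennreal) (auto intro!: ennreal_leI integral_nonneg_AE AE_I2 simp: H0)
  qed auto
  finally have "(\<integral>\<^sup>+\<omega>. (\<Sum>n. ennreal (H n \<omega>)) \<partial>M) \<noteq> \<infinity>"
    by (auto simp: top_unique)
  then have "AE \<omega> in M. (\<Sum>n. ennreal (H n \<omega>)) \<noteq> \<infinity>"
    using intH by (intro nn_integral_PInf_AE) auto
  with AE_space show ?thesis
    by eventually_elim (auto intro!: summable_suminf_not_top simp: H0)
qed

text \<open>
  Doob's maximal inequality for the process started at the first time at which it is at most \<open>e\<close>:
  the probability of reaching the level \<open>l\<close> after that time is at most \<open>e / l\<close>.
\<close>

lemma (in prob_space) supermartingale_rise_prob:
  fixes U :: "nat \<Rightarrow> 'a \<Rightarrow> real"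
  assumes F: "\<And>n. subalgebra M (F n)" and F_mono: "\<And>n. sets (F n) \<subseteq> sets (F (Suc n))"
    and meas: "\<And>n. U n \<in> borel_measurable (F n)" and int: "\<And>n. integrable M (U n)"
    and U0: "\<And>n \<omega>. \<omega> \<in> space M \<Longrightarrow> 0 \<le> U n \<omega>"
    and super: "\<And>n A. A \<in> sets (F n) \<Longrightarrow>
      expectation (\<lambda>\<omega>. indicator A \<omega> * U (Suc n) \<omega>) \<le> expectation (\<lambda>\<omega>. indicator A \<omega> * U n \<omega>)"
    and e: "0 < e" "e < l"
  shows "prob {\<omega>\<in>space M. \<exists>k. \<exists>j\<le>k. U j \<omega> \<le> e \<and> l \<le> U k \<omega>} \<le> e / l"
proof -
  have mono: "sets (F k) \<subseteq> sets (F n)" if "k \<le> n" for k n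
    using that F_mono by (rule lift_Suc_mono_le[of "\<lambda>n. sets (F n)", rotated])
  have sp[simp]: "space (F n) = space M" for n
    using F[of n] by (simp add: subalgebra_def)
  have sub: "sets (F n) \<subseteq> sets M" for n
    using F[of n] by (simp add: subalgebra_def)
  have measF: "U k \<in> borel_measurable (F n)" if "k \<le> n" for k n
    using meas[of k] mono[OF that] by (auto simp: measurable_def)
  have le_F: "{\<omega>\<in>space (F n). U k \<omega> \<le> c} \<in> sets (F n)" "{\<omega>\<in>space (F n). c \<le> U k \<omega>} \<in> sets (F n)"
    if "k \<le> n" for k n c
    using measF[OF that] by measurable
  define A where "A n = {\<omega>\<in>space M. \<exists>j\<le>n. U j \<omega> \<le> e}" for n
  define S where "S n = {\<omega>\<in>space M. \<exists>k\<le>n. \<exists>j\<le>k. U j \<omega> \<le> e \<and> l \<le> U k \<omega>}" for n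
  have A_F: "A n \<in> sets (F n)" for n
  proof -
    have "A n = (\<Union>j\<in>{..n}. {\<omega>\<in>space (F n). U j \<omega> \<le> e})"
      by (auto simp: A_def)
    also have "\<dots> \<in> sets (F n)"
      using le_F by (intro sets.finite_UN) auto
    finally show ?thesis .
  qed
  have S_F: "S n \<in> sets (F n)" for n
  proof -
    have "S n = (\<Union>k\<in>{..n}. \<Union>j\<in>{..k}. {\<omega>\<in>space (F n). U j \<omega> \<le> e} \<inter> {\<omega>\<in>space (F n). l \<le> U k \<omega>})"
      by (auto simp: S_def)
    also have "\<dots> \<in> sets (F n)"
      using le_F by (intro sets.finite_UN sets.Int) auto
    finally show ?thesis .
  qed
  have [measurable]: "A n \<in> sets M" "S n \<in> sets M" for n
    using A_F S_F sub by blast+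
  have [measurable]: "U n \<in> borel_measurable M" for n
    using int[of n] by simp
  have SA: "S n \<subseteq> A n" for n
    unfolding S_def A_def by (auto intro: order_trans)
  have int_ind: "integrable M (\<lambda>\<omega>. indicator B \<omega> * U n \<omega>)" if "B \<in> sets M" for B n
    using integrable_mult_indicator[OF that int[of n]] by simp
  \<comment> \<open>\<open>W\<close> equals \<open>e\<close> until \<open>U\<close> has been at most \<open>e\<close>, then \<open>U\<close> until \<open>U\<close> is at least \<open>l\<close>, and \<open>l\<close>
     from then on; \<open>R\<close> is its part outside the middle phase.\<close>
  define R where "R n \<omega> = indicator (S n) \<omega> * l + indicator (space M - A n) \<omega> * e" for n \<omega>
  define W where "W n \<omega> = R n \<omega> + indicator (A n - S n) \<omega> * U n \<omega>" for n \<omega>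
  have intR: "integrable M (R n)" for n
    unfolding R_def
    by (intro Bochner_Integration.integrable_add integrable_mult_left)
      (auto simp: integrable_indicator_iff emeasure_eq_measure)
  have intW: "integrable M (W n)" for n
    unfolding W_def by (intro Bochner_Integration.integrable_add intR int_ind) measurable
  have step: "W (Suc n) \<omega> \<le> R n \<omega> + indicator (A n - S n) \<omega> * U (Suc n) \<omega>"
    if \<omega>: "\<omega> \<in> space M" for n \<omega>
  proof -
    have ex_Suc: "(\<exists>k\<le>Suc n. P k) \<longleftrightarrow> (\<exists>k\<le>n. P k) \<or> P (Suc n)" for P
      by (auto simp: le_Suc_eq)
    have "\<omega> \<in> S (Suc n) \<longleftrightarrow> (\<exists>k\<le>Suc n. \<exists>j\<le>k. U j \<omega> \<le> e \<and> l \<le> U k \<omega>)"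
      using \<omega> by (simp add: S_def)
    also have "\<dots> \<longleftrightarrow> \<omega> \<in> S n \<or> (\<omega> \<in> A (Suc n) \<and> l \<le> U (Suc n) \<omega>)"
      using \<omega> by (subst ex_Suc) (auto simp: S_def A_def)
    finally have S_Suc: "\<omega> \<in> S (Suc n) \<longleftrightarrow> \<omega> \<in> S n \<or> (\<omega> \<in> A (Suc n) \<and> l \<le> U (Suc n) \<omega>)" .
    have A_Suc: "\<omega> \<in> A (Suc n) \<longleftrightarrow> \<omega> \<in> A n \<or> U (Suc n) \<omega> \<le> e"
      using \<omega> by (auto simp: A_def le_Suc_eq)
    show ?thesis
      using SA[of n] \<omega> e unfolding W_def R_def
      by (auto simp: indicator_def S_Suc A_Suc)
  qed
  have EW: "expectation (W n) \<le> e" for n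
  proof (induction n)
    case 0
    have "W 0 \<omega> \<le> e" if "\<omega> \<in> space M" for \<omega>
      using that e by (auto simp: W_def R_def indicator_def S_def A_def)
    then show ?case
      using integral_le_const[OF intW] by simp
  next
    case (Suc n)
    have "expectation (W (Suc n)) \<le> expectation (\<lambda>\<omega>. R n \<omega> + indicator (A n - S n) \<omega> * U (Suc n) \<omega>)"
      using step by (intro integral_mono intW Bochner_Integration.integrable_add intR int_ind) auto
    also have "\<dots> = expectation (R n) + expectation (\<lambda>\<omega>. indicator (A n - S n) \<omega> * U (Suc n) \<omega>)"
      by (intro Bochner_Integration.integral_add intR int_ind) auto
    also have "\<dots> \<le> expectation (R n) + expectation (\<lambda>\<omega>. indicator (A n - S n) \<omega> * U n \<omega>)"
      using super[of "A n - S n" n] A_F S_F by auto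
    also have "\<dots> = expectation (W n)"
      unfolding W_def by (intro Bochner_Integration.integral_add[symmetric] intR int_ind) auto
    finally show ?case using Suc by simp
  qed
  have pS: "prob (S n) \<le> e / l" for n
  proof -
    have "l * prob (S n) = expectation (\<lambda>\<omega>. indicator (S n) \<omega> * l)"
      by simp
    also have "\<dots> \<le> expectation (W n)"
      using e U0 by (intro integral_mono intW integrable_mult_left integrable_real_indicator)
        (auto simp: W_def R_def emeasure_eq_measure indicator_def)
    also have "\<dots> \<le> e" by (rule EW)
    finally show ?thesis using e by (simp add: field_simps)
  qed
  have "(\<lambda>n. prob (S n)) \<longlonglongrightarrow> prob (\<Union>n. S n)"
  proof (rule finite_Lim_measure_incseq)
    show "incseq S"
      by (auto simp: incseq_def S_def intro: order_trans)
  qed auto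
  then have "prob (\<Union>n. S n) \<le> e / l"
    using pS by (intro LIMSEQ_le_const2) auto
  also have "(\<Union>n. S n) = {\<omega>\<in>space M. \<exists>k. \<exists>j\<le>k. U j \<omega> \<le> e \<and> l \<le> U k \<omega>}"
    by (auto simp: S_def)
  finally show ?thesis .
qed

lemma (in prob_space) supermartingale_tendsto_0:
  fixes U :: "nat \<Rightarrow> 'a \<Rightarrow> real"
  assumes F: "\<And>n. subalgebra M (F n)" "\<And>n. sets (F n) \<subseteq> sets (F (Suc n))"
    and meas: "\<And>n. U n \<in> borel_measurable (F n)" and int: "\<And>n. integrable M (U n)"
    and U0: "\<And>n \<omega>. \<omega> \<in> space M \<Longrightarrow> 0 \<le> U n \<omega>"
    and super: "\<And>n A. A \<in> sets (F n) \<Longrightarrow>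
      expectation (\<lambda>\<omega>. indicator A \<omega> * U (Suc n) \<omega>) \<le> expectation (\<lambda>\<omega>. indicator A \<omega> * U n \<omega>)"
    and small: "AE \<omega> in M. \<forall>e>0. \<exists>n. U n \<omega> \<le> e"
  shows "AE \<omega> in M. (\<lambda>n. U n \<omega>) \<longlonglongrightarrow> 0"
proof -
  have [measurable]: "U n \<in> borel_measurable M" for n
    using int[of n] by simp
  have AE_l: "AE \<omega> in M. eventually (\<lambda>n. U n \<omega> < l) sequentially" if l: "l > 0" for l
  proof -
    define B where "B = {\<omega>\<in>space M. (\<forall>i. \<exists>n. U n \<omega> \<le> 1 / Suc i) \<and> \<not> eventually (\<lambda>n. U n \<omega> < l) sequentially}"
    have [measurable]: "B \<in> events"
      unfolding B_def by measurable
    have "prob B \<le> e" if e: "e > 0" for e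
    proof -
      \<comment> \<open>The rise from a level \<open>d\<close> to \<open>l\<close> has probability at most \<open>d / l \<le> e\<close>, for \<open>d < l\<close>.\<close>
      define d where "d = min (e * l) (l / 2)"
      have d: "0 < d" "d < l" using e l by (auto simp: d_def)
      obtain i where i: "1 / Suc i < d" using nat_approx_posE[OF d(1)] by (metis of_nat_Suc)
      have "B \<subseteq> {\<omega>\<in>space M. \<exists>k. \<exists>j\<le>k. U j \<omega> \<le> d \<and> l \<le> U k \<omega>}"
      proof safe
        fix \<omega> assume \<omega>: "\<omega> \<in> B"
        then show "\<omega> \<in> space M" by (simp add: B_def)
        obtain j where "U j \<omega> \<le> 1 / Suc i" using \<omega> by (auto simp: B_def)
        then have j: "U j \<omega> \<le> d" using i by linarith
        obtain k where "k \<ge> j" "\<not> U k \<omega> < l"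
          using \<omega> unfolding B_def eventually_sequentially by auto
        then show "\<exists>k. \<exists>j\<le>k. U j \<omega> \<le> d \<and> l \<le> U k \<omega>"
          using j by (auto simp: not_less)
      qed
      then have "prob B \<le> prob {\<omega>\<in>space M. \<exists>k. \<exists>j\<le>k. U j \<omega> \<le> d \<and> l \<le> U k \<omega>}"
        by (intro finite_measure_mono) measurable
      also have "\<dots> \<le> d / l"
        using F meas int U0 super d by (rule supermartingale_rise_prob)
      also have "\<dots> \<le> e"
        using l by (simp add: d_def field_simps)
      finally show ?thesis .
    qed
    then have "prob B = 0"
      by (meson field_le_epsilon antisym measure_nonneg add_0 le_cases order_trans dense_ge)
    then have "AE \<omega> in M. \<omega> \<notin> B"
      by (intro AE_not_in) (simp add: emeasure_eq_measure null_sets_def)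
    with small AE_space show ?thesis
      by eventually_elim (auto simp: B_def)
  qed
  have "AE \<omega> in M. \<forall>i. eventually (\<lambda>n. U n \<omega> < 1 / Suc i) sequentially"
    unfolding AE_all_countable by (auto intro!: AE_l)
  with AE_space show ?thesis
  proof eventually_elim
    fix \<omega> assume \<omega>: "\<omega> \<in> space M" "\<forall>i. eventually (\<lambda>n. U n \<omega> < 1 / Suc i) sequentially"
    show "(\<lambda>n. U n \<omega>) \<longlonglongrightarrow> 0"
    proof (rule order_tendstoI)
      fix a :: real assume "a < 0"
      then show "eventually (\<lambda>n. a < U n \<omega>) sequentially"
        using U0[OF \<omega>(1)] by (auto intro!: always_eventually intro: less_le_trans)
    next
      fix a :: real assume "0 < a"
      then obtain i where i: "1 / Suc i < a" using nat_approx_posE by (metis of_nat_Suc)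
      from \<omega>(2) have "eventually (\<lambda>n. U n \<omega> < 1 / Suc i) sequentially" by blast
      then show "eventually (\<lambda>n. U n \<omega> < a) sequentially"
        by eventually_elim (use i in linarith)
    qed
  qed
qed

section \<open>Lyapunov functions of Markov chains\<close>

lemma expectation_bind_pmf_finite:
  fixes f :: "'b \<Rightarrow> real"
  assumes "finite (set_pmf p)" "\<And>x. x \<in> set_pmf p \<Longrightarrow> finite (set_pmf (q x))"
  shows "measure_pmf.expectation (p \<bind> q) f =
    measure_pmf.expectation p (\<lambda>x. measure_pmf.expectation (q x) f)"
  using assms by (subst pmf_expectation_bind[of "set_pmf p"]) (auto simp: integral_measure_pmf[of "set_pmf p"])

text \<open>
  A time-homogeneous Markov chain with transition kernel \<open>K\<close>, started in \<open>s0\<close>, described by the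
  conditional laws given the whole history.
\<close>

locale countable_markov_chain = prob_space M
  for M :: "'a measure" and K :: "'s :: countable \<Rightarrow> 's pmf" and s0 :: 's
    and X :: "nat \<Rightarrow> 'a \<Rightarrow> 's" +
  assumes measurable_X [measurable]: "\<And>n. X n \<in> measurable M (count_space UNIV)"
    and initial_state: "AE \<omega> in M. X 0 \<omega> = s0"
    and step: "\<And>n h s. \<P>(\<omega> in M. \<forall>k\<le>n. X k \<omega> = h k) > 0 \<Longrightarrow>
      \<P>(\<omega> in M. X (Suc n) \<omega> = s \<bar> \<forall>k\<le>n. X k \<omega> = h k) = pmf (K (h n)) s"
begin

text \<open>
  The list of the states at the times \<open>0, \<dots>, n\<close>, and the law that the kernel prescribes for it.
\<close>

definition history :: "nat \<Rightarrow> 'a \<Rightarrow> 's list" where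
  "history n \<omega> = map (\<lambda>k. X k \<omega>) [0..<Suc n]"

primrec history_pmf :: "nat \<Rightarrow> 's list pmf" where
  "history_pmf 0 = return_pmf [s0]"
| "history_pmf (Suc n) = history_pmf n \<bind> (\<lambda>h. map_pmf (\<lambda>s. h @ [s]) (K (last h)))"

lemma history_Suc: "history (Suc n) \<omega> = history n \<omega> @ [X (Suc n) \<omega>]"
  by (simp add: history_def)

lemma last_history [simp]: "last (history n \<omega>) = X n \<omega>"
  by (simp add: history_def)

lemma history_eq_iff: "history n \<omega> = h \<longleftrightarrow> length h = Suc n \<and> (\<forall>k\<le>n. X k \<omega> = h ! k)"
  by (auto simp: history_def list_eq_iff_nth_eq simp del: upt_Suc)

lemma pmf_history_pmf_snoc:
  "pmf (history_pmf (Suc n)) (h @ [s]) = pmf (history_pmf n) h * pmf (K (last h)) s"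
proof -
  have "pmf (map_pmf (\<lambda>t. h' @ [t]) (K (last h'))) (h @ [s]) = indicator {h} h' * pmf (K (last h)) s" for h'
  proof (cases "h' = h")
    case True
    have "inj (\<lambda>t. h @ [t])" by (auto intro: injI)
    from pmf_map_inj'[OF this, of "K (last h)" s] True show ?thesis by simp
  next
    case False
    then show ?thesis by (auto simp: pmf_eq_0_set_pmf)
  qed
  then show ?thesis
    by (simp add: pmf_bind measure_pmf_single)
qed

lemma measurable_history [measurable]: "history n \<in> measurable M (count_space UNIV)"
proof (subst measurable_count_space_eq2_countable)
  have "history n -` {h} \<inter> space M \<in> events" for h
  proof -
    have "history n -` {h} \<inter> space M = {\<omega>\<in>space M. length h = Suc n \<and> (\<forall>k\<le>n. X k \<omega> = h ! k)}"
      by (auto simp: history_eq_iff[symmetric])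
    then show ?thesis by simp
  qed
  then show "history n \<in> space M \<rightarrow> UNIV \<and> (\<forall>h\<in>UNIV. history n -` {h} \<inter> space M \<in> events)"
    by simp
qed

lemma prob_history: "prob {\<omega>\<in>space M. history n \<omega> = h} = pmf (history_pmf n) h"
proof (induction n arbitrary: h)
  case 0
  have "prob {\<omega>\<in>space M. history 0 \<omega> = h} = prob {\<omega>\<in>space M. [s0] = h}"
    using initial_state by (intro finite_measure_eq_AE) (auto simp: history_def)
  then show ?case by (cases "h = [s0]") (auto simp: prob_space)
next
  case (Suc n)
  show ?case
  proof (cases h rule: rev_cases)
    case Nil
    have "[] \<notin> set_pmf (history_pmf (Suc n))" by auto
    then show ?thesis using Nil by (simp add: history_def pmf_eq_0_set_pmf del: history_pmf.simps)
  next
    case (snoc h' s)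
    let ?Q = "\<lambda>\<omega>. \<forall>k\<le>n. X k \<omega> = h' ! k"
    show ?thesis
    proof (cases "prob {\<omega>\<in>space M. history n \<omega> = h'} = 0")
      case True
      have "prob {\<omega>\<in>space M. history (Suc n) \<omega> = h} \<le> prob {\<omega>\<in>space M. history n \<omega> = h'}"
        by (intro finite_measure_mono) (auto simp: snoc history_Suc)
      then show ?thesis
        using True Suc.IH[of h'] measure_nonneg[of M] unfolding snoc pmf_history_pmf_snoc
        by (simp add: antisym)
    next
      case False
      then have len: "length h' = Suc n"
        by (rule contrapos_np) (simp add: history_eq_iff)
      then have eq: "{\<omega>\<in>space M. history n \<omega> = h'} = {\<omega>\<in>space M. ?Q \<omega>}"
        by (simp add: history_eq_iff)
      have pos: "prob {\<omega>\<in>space M. ?Q \<omega>} > 0"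
        using False measure_nonneg[of M] unfolding eq by (simp add: less_le)
      have last: "last h' = h' ! n"
        using len by (subst last_conv_nth) auto
      have "prob {\<omega>\<in>space M. X (Suc n) \<omega> = s \<and> ?Q \<omega>} = prob {\<omega>\<in>space M. ?Q \<omega>} * pmf (K (h' ! n)) s"
        using step[of n "(!) h'" s, OF pos] pos by (simp add: cond_prob_def field_simps)
      moreover have "{\<omega>\<in>space M. history (Suc n) \<omega> = h} = {\<omega>\<in>space M. X (Suc n) \<omega> = s \<and> ?Q \<omega>}"
        using len by (auto simp: snoc history_Suc history_eq_iff)
      ultimately show ?thesis
        using Suc.IH[of h'] unfolding snoc pmf_history_pmf_snoc eq last by simp
    qed
  qed
qed

text \<open>
  The state space is countable, so the law of the history is determined by its point masses.
\<close>

lemma distr_history: "distr M (count_space UNIV) (history n) = measure_pmf (history_pmf n)"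
proof (rule measure_eqI_countable[of _ UNIV])
  fix h :: "'s list"
  have "emeasure (distr M (count_space UNIV) (history n)) {h} = emeasure M {\<omega>\<in>space M. history n \<omega> = h}"
    by (subst emeasure_distr) (auto intro!: arg_cong[where f="emeasure M"])
  then show "emeasure (distr M (count_space UNIV) (history n)) {h} = emeasure (measure_pmf (history_pmf n)) {h}"
    by (simp add: emeasure_eq_measure prob_history emeasure_pmf_single)
qed auto

lemma expectation_history:
  fixes f :: "'s list \<Rightarrow> real"
  shows "expectation (\<lambda>\<omega>. f (history n \<omega>)) = measure_pmf.expectation (history_pmf n) f"
  by (subst distr_history[symmetric], subst integral_distr) auto

lemma AE_history: "(AE \<omega> in M. P (history n \<omega>)) \<longleftrightarrow> (\<forall>h\<in>set_pmf (history_pmf n). P h)"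
  by (subst AE_measure_pmf_iff[symmetric], subst distr_history[symmetric], subst AE_distr_iff) auto

lemma AE_step: "AE \<omega> in M. \<forall>n. X (Suc n) \<omega> \<in> set_pmf (K (X n \<omega>))"
proof (subst AE_all_countable, rule allI)
  fix n
  have "AE \<omega> in M. last (history (Suc n) \<omega>) \<in> set_pmf (K (last (butlast (history (Suc n) \<omega>))))"
    by (subst AE_history) auto
  then show "AE \<omega> in M. X (Suc n) \<omega> \<in> set_pmf (K (X n \<omega>))"
    by (simp add: history_Suc)
qed

lemma AE_invariant:
  assumes "I s0" "\<And>s t. I s \<Longrightarrow> t \<in> set_pmf (K s) \<Longrightarrow> I t"
  shows "AE \<omega> in M. \<forall>n. I (X n \<omega>)"
  using initial_state AE_step
proof eventually_elim
  case (elim \<omega>)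
  have "I (X n \<omega>)" for n
    by (induction n) (use elim assms in auto)
  then show ?case by blast
qed

text \<open>
  The Lyapunov criterion, relative to an invariant set \<open>I\<close> that contains the initial state: \<open>V\<close>
  decreases in mean by at least \<open>D\<close> in each step.
\<close>

lemma
  fixes I :: "'s \<Rightarrow> bool" and V D :: "'s \<Rightarrow> real"
  assumes I0: "I s0" and I_step: "\<And>s t. I s \<Longrightarrow> t \<in> set_pmf (K s) \<Longrightarrow> I t"
    and fin: "\<And>s. I s \<Longrightarrow> finite (set_pmf (K s))"
    and V0: "\<And>s. I s \<Longrightarrow> 0 \<le> V s" and D0: "\<And>s. I s \<Longrightarrow> 0 \<le> D s"
    and drift: "\<And>s. I s \<Longrightarrow> measure_pmf.expectation (K s) V \<le> V s - D s"
  shows AE_summable_decrements: "AE \<omega> in M. summable (\<lambda>n. D (X n \<omega>))"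
    and AE_Lyapunov_tendsto_0: "AE \<omega> in M. \<forall>e>0. \<exists>n. V (X n \<omega>) \<le> e \<Longrightarrow>
      AE \<omega> in M. (\<lambda>n. V (X n \<omega>)) \<longlonglongrightarrow> 0"
proof -
  \<comment> \<open>The supermartingale must be nonnegative everywhere, so \<open>V\<close> and \<open>D\<close> are cut off outside \<open>I\<close>.\<close>
  define V' where "V' s = (if I s then V s else 0)" for s
  define D' where "D' s = (if I s then D s else 0)" for s
  define F where "F n = vimage_algebra (space M) (history n) (count_space UNIV)" for n
  have I_hist: "h \<noteq> [] \<and> I (last h)" if "h \<in> set_pmf (history_pmf n)" for n h
    using that
  proof (induction n arbitrary: h)
    case (Suc n)
    then obtain h' s where "h' \<in> set_pmf (history_pmf n)" "s \<in> set_pmf (K (last h'))" "h = h' @ [s]"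
      by auto
    then show ?case using Suc.IH[of h'] I_step by auto
  qed (use I0 in auto)
  have fin_hist: "finite (set_pmf (history_pmf n))" for n
  proof (induction n)
    case (Suc n)
    then show ?case using I_hist[of _ n] fin by auto
  qed auto
  have int: "integrable M (\<lambda>\<omega>. f (history n \<omega>))" for n and f :: "'s list \<Rightarrow> real"
  proof -
    have "integrable (distr M (count_space UNIV) (history n)) f"
      unfolding distr_history by (intro integrable_measure_pmf_finite fin_hist)
    then show ?thesis
      by (subst (asm) integrable_distr_eq) auto
  qed
  have intV: "integrable M (\<lambda>\<omega>. f (X n \<omega>))" for n and f :: "'s \<Rightarrow> real"
    using int[of "\<lambda>h. f (last h)" n] by simp
  have sets_F: "sets (F n) = {history n -` B \<inter> space M | B. True}" for n
    unfolding F_def by (subst sets_vimage_algebra2) auto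
  have sub: "subalgebra M (F n)" for n
    unfolding subalgebra_def sets_F by (auto simp: F_def intro: measurable_sets[OF measurable_history])
  have F_mono: "sets (F n) \<subseteq> sets (F (Suc n))" for n
  proof
    fix A assume "A \<in> sets (F n)"
    then obtain B where "A = history n -` B \<inter> space M" by (auto simp: sets_F)
    then have "A = history (Suc n) -` (butlast -` B) \<inter> space M"
      by (auto simp: history_Suc)
    then show "A \<in> sets (F (Suc n))" unfolding sets_F by blast
  qed
  have meas: "(\<lambda>\<omega>. V' (X n \<omega>)) \<in> borel_measurable (F n)" for n
  proof -
    have "history n \<in> F n \<rightarrow>\<^sub>M count_space UNIV"
      unfolding F_def by (intro measurable_vimage_algebra1) auto
    moreover have "(\<lambda>h. V' (last h)) \<in> count_space UNIV \<rightarrow>\<^sub>M borel" by simp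
    ultimately have "(\<lambda>\<omega>. V' (last (history n \<omega>))) \<in> borel_measurable (F n)"
      by (rule measurable_compose)
    then show ?thesis by simp
  qed
  have super: "expectation (\<lambda>\<omega>. indicator A \<omega> * V' (X (Suc n) \<omega>)) \<le>
    expectation (\<lambda>\<omega>. indicator A \<omega> * (V' (X n \<omega>) - D' (X n \<omega>)))" if A: "A \<in> sets (F n)" for n A
  proof -
    obtain B where B: "A = history n -` B \<inter> space M" using A by (auto simp: sets_F)
    have "expectation (\<lambda>\<omega>. indicator A \<omega> * V' (X (Suc n) \<omega>)) =
      expectation (\<lambda>\<omega>. (\<lambda>h. indicator B (butlast h) * V' (last h)) (history (Suc n) \<omega>))"
      by (intro Bochner_Integration.integral_cong) (auto simp: B history_Suc indicator_def)
    also have "\<dots> = measure_pmf.expectation (history_pmf (Suc n)) (\<lambda>h. indicator B (butlast h) * V' (last h))"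
      by (rule expectation_history)
    also have "\<dots> = measure_pmf.expectation (history_pmf n)
        (\<lambda>h. indicator B h * measure_pmf.expectation (K (last h)) V')"
      using I_hist fin unfolding history_pmf.simps
      by (subst expectation_bind_pmf_finite[OF fin_hist]) auto
    also have "\<dots> \<le> measure_pmf.expectation (history_pmf n)
        (\<lambda>h. indicator B h * (V' (last h) - D' (last h)))"
    proof (intro integral_mono_AE integrable_measure_pmf_finite fin_hist)
      show "AE h in measure_pmf (history_pmf n). indicator B h * measure_pmf.expectation (K (last h)) V' \<le>
        indicator B h * (V' (last h) - D' (last h))"
        unfolding AE_measure_pmf_iff
      proof
        fix h assume "h \<in> set_pmf (history_pmf n)"
        then have Ih: "I (last h)" using I_hist by blast
        have "measure_pmf.expectation (K (last h)) V' = measure_pmf.expectation (K (last h)) V"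
          by (intro integral_cong_AE) (auto simp: AE_measure_pmf_iff V'_def dest: I_step[OF Ih])
        then show "indicator B h * measure_pmf.expectation (K (last h)) V' \<le>
            indicator B h * (V' (last h) - D' (last h))"
          using drift[OF Ih] Ih by (intro mult_left_mono) (auto simp: V'_def D'_def)
      qed
    qed
    also have "\<dots> = expectation (\<lambda>\<omega>. (\<lambda>h. indicator B h * (V' (last h) - D' (last h))) (history n \<omega>))"
      by (rule expectation_history[symmetric])
    also have "\<dots> = expectation (\<lambda>\<omega>. indicator A \<omega> * (V' (X n \<omega>) - D' (X n \<omega>)))"
      by (intro Bochner_Integration.integral_cong) (auto simp: B indicator_def)
    finally show ?thesis .
  qed
  have V'0: "0 \<le> V' s" and D'0: "0 \<le> D' s" for s
    by (auto simp: V'_def D'_def V0 D0)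
  have AE_I: "AE \<omega> in M. \<forall>n. I (X n \<omega>)"
    using I0 I_step by (rule AE_invariant)
  have "AE \<omega> in M. summable (\<lambda>n. D' (X n \<omega>))"
  proof (rule supermartingale_summable_decrements[where U = "\<lambda>n \<omega>. V' (X n \<omega>)"])
    fix n
    have "space M \<in> sets (F n)"
      using sets.top[of "F n"] by (simp add: F_def)
    then have "expectation (\<lambda>\<omega>. indicator (space M) \<omega> * V' (X (Suc n) \<omega>)) \<le>
        expectation (\<lambda>\<omega>. indicator (space M) \<omega> * (V' (X n \<omega>) - D' (X n \<omega>)))"
      by (rule super)
    then have "expectation (\<lambda>\<omega>. V' (X (Suc n) \<omega>)) \<le> expectation (\<lambda>\<omega>. V' (X n \<omega>) - D' (X n \<omega>))"
      by (simp cong: Bochner_Integration.integral_cong)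
    then show "expectation (\<lambda>\<omega>. V' (X (Suc n) \<omega>)) \<le>
        expectation (\<lambda>\<omega>. V' (X n \<omega>)) - expectation (\<lambda>\<omega>. D' (X n \<omega>))"
      by (simp add: Bochner_Integration.integral_diff intV)
  qed (use V'0 D'0 intV in auto)
  with AE_I show "AE \<omega> in M. summable (\<lambda>n. D (X n \<omega>))"
    by eventually_elim (simp add: D'_def)
  assume small: "AE \<omega> in M. \<forall>e>0. \<exists>n. V (X n \<omega>) \<le> e"
  have "AE \<omega> in M. (\<lambda>n. V' (X n \<omega>)) \<longlonglongrightarrow> 0"
  proof (rule supermartingale_tendsto_0[where F = F and U = "\<lambda>n \<omega>. V' (X n \<omega>)", OF sub F_mono meas intV])
    fix n A assume A: "A \<in> sets (F n)"
    have "expectation (\<lambda>\<omega>. indicator A \<omega> * (V' (X n \<omega>) - D' (X n \<omega>))) \<le>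
        expectation (\<lambda>\<omega>. indicator A \<omega> * V' (X n \<omega>))"
    proof (rule integral_mono)
      have "A \<in> events" using A sub[of n] by (auto simp: subalgebra_def)
      then show "integrable M (\<lambda>\<omega>. indicator A \<omega> * (V' (X n \<omega>) - D' (X n \<omega>)))"
        "integrable M (\<lambda>\<omega>. indicator A \<omega> * V' (X n \<omega>))"
        using integrable_mult_indicator[of A M "\<lambda>\<omega>. V' (X n \<omega>) - D' (X n \<omega>)"]
          integrable_mult_indicator[of A M "\<lambda>\<omega>. V' (X n \<omega>)"] intV by simp_all
    qed (use D'0 in \<open>auto simp: indicator_def\<close>)
    then show "expectation (\<lambda>\<omega>. indicator A \<omega> * V' (X (Suc n) \<omega>)) \<le>
        expectation (\<lambda>\<omega>. indicator A \<omega> * V' (X n \<omega>))"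
      using super[OF A] by simp
  next
    show "AE \<omega> in M. \<forall>e>0. \<exists>n. V' (X n \<omega>) \<le> e"
      using AE_I small by eventually_elim (simp add: V'_def)
  qed (use V'0 in auto)
  with AE_I show "AE \<omega> in M. (\<lambda>n. V (X n \<omega>)) \<longlonglongrightarrow> 0"
    by eventually_elim (simp add: V'_def)
qed

end

section \<open>A uniformly chosen type of a random sample\<close>

text \<open>
  A sample of size \<open>m\<close> is a word of length \<open>m\<close> over the finite set \<open>I\<close> of types; its letters are
  drawn independently with probabilities \<open>x\<close>, so that a word has probability \<open>word_prob x w\<close>.
\<close>

definition words :: "'b set \<Rightarrow> nat \<Rightarrow> 'b list set" where
  "words I m = {w. set w \<subseteq> I \<and> length w = m}"

lemma finite_words: "finite I \<Longrightarrow> finite (words I m)"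
  unfolding words_def by (rule finite_lists_length_eq)

lemma sum_words_Suc:
  assumes "finite I"
  shows "(\<Sum>w\<in>words I (Suc m). f w) = (\<Sum>a\<in>I. \<Sum>w\<in>words I m. f (a # w))"
proof -
  have "words I (Suc m) = (\<lambda>(a, w). a # w) ` (I \<times> words I m)"
    by (auto simp: words_def length_Suc_conv image_iff)
  moreover have "inj_on (\<lambda>(a, w). a # w) (I \<times> words I m)"
    by (auto simp: inj_on_def)
  ultimately have "(\<Sum>w\<in>words I (Suc m). f w) = (\<Sum>(a, w)\<in>I \<times> words I m. f (a # w))"
    by (simp add: sum.reindex case_prod_unfold)
  then show ?thesis by (simp add: sum.cartesian_product)
qed

definition word_prob :: "('b \<Rightarrow> real) \<Rightarrow> 'b list \<Rightarrow> real" where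
  "word_prob x w = prod_list (map x w)"

lemma sum_word_prob:
  assumes "finite I" "sum x I = 1"
  shows "(\<Sum>w\<in>words I m. word_prob x w) = 1"
proof (induction m)
  case 0
  have "words I 0 = {[]}" by (auto simp: words_def)
  then show ?case by (simp add: word_prob_def)
next
  case (Suc m)
  have "(\<Sum>w\<in>words I (Suc m). word_prob x w) = (\<Sum>a\<in>I. x a * (\<Sum>w\<in>words I m. word_prob x w))"
    by (simp add: sum_words_Suc[OF assms(1)] word_prob_def sum_distrib_left)
  then show ?case using Suc assms(2) by simp
qed

lemma sum_word_prob_count:
  assumes "finite I" "sum x I = 1" "i \<in> I"
  shows "(\<Sum>w\<in>words I m. word_prob x w * count_list w i) = m * x i"
proof (induction m)
  case 0
  have "words I 0 = {[]}" by (auto simp: words_def)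
  then show ?case by (simp add: word_prob_def)
next
  case (Suc m)
  have "(\<Sum>w\<in>words I (Suc m). word_prob x w * count_list w i) =
    (\<Sum>a\<in>I. \<Sum>w\<in>words I m. x a * (word_prob x w * count_list w i) + (if a = i then x a * word_prob x w else 0))"
    unfolding sum_words_Suc[OF assms(1)]
    by (intro sum.cong refl) (auto simp: word_prob_def algebra_simps)
  also have "\<dots> = (\<Sum>a\<in>I. x a * (\<Sum>w\<in>words I m. word_prob x w * count_list w i) +
     (if a = i then x a * (\<Sum>w\<in>words I m. word_prob x w) else 0))"
    by (intro sum.cong refl) (simp add: sum.distrib sum_distrib_left)
  also have "\<dots> = (\<Sum>a\<in>I. x a * (\<Sum>w\<in>words I m. word_prob x w * count_list w i)) +
     (\<Sum>a\<in>I. if a = i then x a * (\<Sum>w\<in>words I m. word_prob x w) else 0)"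
    by (rule sum.distrib)
  also have "\<dots> = m * x i + x i"
    using assms by (simp add: Suc sum_word_prob flip: sum_distrib_right)
  finally show ?case by (simp add: algebra_simps)
qed

lemma word_prob_split:
  assumes "i \<noteq> j"
  shows "word_prob x w =
    x i ^ count_list w i * x j ^ count_list w j * word_prob x (filter (\<lambda>k. k \<noteq> i \<and> k \<noteq> j) w)"
  using assms by (induction w) (auto simp: word_prob_def)

lemma count_list_map_transpose:
  "count_list (map (Transposition.transpose i j) w) i = count_list w j"
  "count_list (map (Transposition.transpose i j) w) j = count_list w i"
  by (induction w) (auto simp: Transposition.transpose_def)

lemma filter_map_transpose:
  "filter (\<lambda>k. k \<noteq> i \<and> k \<noteq> j) (map (Transposition.transpose i j) w) = filter (\<lambda>k. k \<noteq> i \<and> k \<noteq> j) w"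
  by (induction w) (auto simp: Transposition.transpose_def)

lemma word_prob_nonneg: "(\<And>a. a \<in> set w \<Longrightarrow> 0 \<le> x a) \<Longrightarrow> 0 \<le> word_prob x w"
  by (induction w) (auto simp: word_prob_def)

lemma word_prob_le_1: "(\<And>a. a \<in> set w \<Longrightarrow> 0 \<le> x a \<and> x a \<le> 1) \<Longrightarrow> word_prob x w \<le> 1"
proof (induction w)
  case (Cons a w)
  then show ?case
    using word_prob_nonneg[of w x] by (auto simp: word_prob_def intro!: mult_le_one)
qed (simp add: word_prob_def)

lemma sum_words_transpose:
  assumes "i \<in> I" "j \<in> I"
  shows "(\<Sum>w\<in>words I m. f (map (Transposition.transpose i j) w)) = (\<Sum>w\<in>words I m. f w)"
proof (rule sum.reindex_bij_witness[of _ "map (Transposition.transpose i j)" "map (Transposition.transpose i j)"])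
  have tr: "Transposition.transpose i j a \<in> I" if "a \<in> I" for a
    using that assms by (auto simp: Transposition.transpose_def)
  show "map (Transposition.transpose i j) w \<in> words I m" if "w \<in> words I m" for w
    using that tr by (auto simp: words_def)
  then show "map (Transposition.transpose i j) w \<in> words I m" if "w \<in> words I m" for w
    using that by blast
qed (auto simp: o_def)

text \<open>
  The expected difference of the numbers of occurrences of \<open>i\<close> and \<open>j\<close> in a sample, divided by the
  number of types present, on the event that both occur.
\<close>

definition pair_bias :: "'b set \<Rightarrow> nat \<Rightarrow> ('b \<Rightarrow> real) \<Rightarrow> 'b \<Rightarrow> 'b \<Rightarrow> real" where
  "pair_bias I m x i j = (\<Sum>w\<in>words I m. word_prob x w *
     (if i \<in> set w \<and> j \<in> set w then (real (count_list w i) - real (count_list w j)) / card (set w) else 0))"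

text \<open>
  The probability that \<open>i\<close> is chosen when a type is picked uniformly from those that occur in the
  sample.
\<close>

definition adopt_prob :: "'b set \<Rightarrow> nat \<Rightarrow> ('b \<Rightarrow> real) \<Rightarrow> 'b \<Rightarrow> real" where
  "adopt_prob I m x i = (\<Sum>w\<in>words I m. word_prob x w * (if i \<in> set w then 1 / card (set w) else 0))"

lemma pair_bias_antisym: "pair_bias I m x j i = - pair_bias I m x i j"
  unfolding pair_bias_def sum_negf[symmetric]
  by (intro sum.cong refl) (auto simp: diff_divide_distrib right_diff_distrib)

lemma sum_count_list: "finite I \<Longrightarrow> set w \<subseteq> I \<Longrightarrow> (\<Sum>j\<in>I. count_list w j) = length w"
  by (metis sum.mono_neutral_left sum_count_set)

text \<open>
  The numbers of occurrences of all types add up to \<open>m\<close>. Hence, if \<open>i\<close> occurs in a sample with \<open>k\<close>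
  different types, the terms for that sample add up to the number of occurrences of \<open>i\<close> minus
  \<open>m / k\<close>.
\<close>

lemma sum_pair_bias:
  assumes I: "finite I" and x: "sum x I = 1" and i: "i \<in> I"
  shows "(\<Sum>j\<in>I. pair_bias I m x i j) = m * x i - m * adopt_prob I m x i"
proof -
  have *: "(\<Sum>j\<in>I. if i \<in> set w \<and> j \<in> set w
        then (real (count_list w i) - real (count_list w j)) / card (set w) else 0)
      = real (count_list w i) - (if i \<in> set w then m / card (set w) else 0)" if w: "w \<in> words I m" for w
  proof (cases "i \<in> set w")
    case True
    then have c: "0 < card (set w)" by (auto simp: card_gt_0_iff)
    have "(\<Sum>j\<in>I. if j \<in> set w then (real (count_list w i) - real (count_list w j)) / card (set w) else 0)
      = (\<Sum>j\<in>set w. (real (count_list w i) - real (count_list w j)) / card (set w))"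
      using w I by (simp add: words_def sum.inter_restrict[symmetric] Int_absorb1 Int_commute)
    also have "\<dots> = (card (set w) * real (count_list w i) - real (\<Sum>j\<in>set w. count_list w j)) / card (set w)"
      by (simp add: sum_divide_distrib[symmetric] sum_subtractf)
    also have "(\<Sum>j\<in>set w. count_list w j) = m"
      using w by (simp add: sum_count_list words_def)
    also have "(card (set w) * real (count_list w i) - real m) / card (set w) =
        real (count_list w i) - m / card (set w)"
      using c by (simp add: diff_divide_distrib)
    finally show ?thesis using True by simp
  next
    case False
    then show ?thesis by (simp add: count_list_0_iff)
  qed
  have "(\<Sum>j\<in>I. pair_bias I m x i j) = (\<Sum>w\<in>words I m. word_prob x w *
      (real (count_list w i) - (if i \<in> set w then m / card (set w) else 0)))"
    unfolding pair_bias_def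
    by (subst sum.swap) (simp add: sum_distrib_left[symmetric] * cong: sum.cong)
  also have "\<dots> = (\<Sum>w\<in>words I m. word_prob x w * count_list w i) - m * adopt_prob I m x i"
    unfolding adopt_prob_def sum_distrib_left sum_subtractf[symmetric]
    by (intro sum.cong refl) (auto simp: algebra_simps)
  finally show ?thesis using sum_word_prob_count[OF I x i] by simp
qed

text \<open>
  The joint contribution of a word and of the word with \<open>i\<close> and \<open>j\<close> exchanged. If \<open>i\<close> and \<open>j\<close>
  occur \<open>a\<close> and \<open>b\<close> times, the two probabilities are \<open>x i ^ a * x j ^ b\<close> and \<open>x i ^ b * x j ^ a\<close>
  times the probability of the remaining letters.
\<close>

definition swap_term :: "('b \<Rightarrow> real) \<Rightarrow> 'b \<Rightarrow> 'b \<Rightarrow> 'b list \<Rightarrow> real" where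
  "swap_term x i j w =
    (if i \<in> set w \<and> j \<in> set w then word_prob x (filter (\<lambda>k. k \<noteq> i \<and> k \<noteq> j) w) / card (set w) *
      ((real (count_list w i) - real (count_list w j)) *
       (x i ^ count_list w i * x j ^ count_list w j - x i ^ count_list w j * x j ^ count_list w i)) else 0)"

lemma pair_bias_symmetrized:
  assumes ij: "i \<in> I" "j \<in> I" "i \<noteq> j"
  shows "2 * pair_bias I m x i j = (\<Sum>w\<in>words I m. swap_term x i j w)"
proof -
  let ?f = "\<lambda>w. word_prob x w *
     (if i \<in> set w \<and> j \<in> set w then (real (count_list w i) - real (count_list w j)) / card (set w) else 0)"
  have mem: "i \<in> set (map (Transposition.transpose i j) w) \<longleftrightarrow> j \<in> set w"
    "j \<in> set (map (Transposition.transpose i j) w) \<longleftrightarrow> i \<in> set w" for w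
    using count_list_map_transpose[of i j w] by (metis count_list_0_iff)+
  have card: "card (set (map (Transposition.transpose i j) w)) = card (set w)" for w
    unfolding set_map by (rule card_image) (meson inj_on_subset inj_transpose subset_UNIV)
  have "2 * pair_bias I m x i j = (\<Sum>w\<in>words I m. ?f w) + (\<Sum>w\<in>words I m. ?f (map (Transposition.transpose i j) w))"
    unfolding sum_words_transpose[OF ij(1,2), where m = m and f = ?f] by (simp add: pair_bias_def)
  also have "\<dots> = (\<Sum>w\<in>words I m. ?f w + ?f (map (Transposition.transpose i j) w))"
    by (rule sum.distrib[symmetric])
  also have "\<dots> = (\<Sum>w\<in>words I m. swap_term x i j w)"
  proof (intro sum.cong refl, goal_cases)
    case (1 w)
    define R where "R = word_prob x (filter (\<lambda>k. k \<noteq> i \<and> k \<noteq> j) w)"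
    have "word_prob x w = x i ^ count_list w i * x j ^ count_list w j * R"
      unfolding R_def by (rule word_prob_split[OF ij(3)])
    moreover have "word_prob x (map (Transposition.transpose i j) w) =
        x i ^ count_list w j * x j ^ count_list w i * R"
      using word_prob_split[OF ij(3), of x "map (Transposition.transpose i j) w"]
      unfolding filter_map_transpose count_list_map_transpose R_def .
    ultimately show ?case
      unfolding count_list_map_transpose mem card swap_term_def R_def[symmetric]
      by (auto simp: diff_divide_distrib algebra_simps)
  qed
  finally show ?thesis .
qed

lemma diff_mult_diff_power_nonneg:
  fixes y z :: real
  assumes "0 \<le> y" "0 \<le> z"
  shows "0 \<le> (y - z) * ((real a - real b) * (y ^ a * z ^ b - y ^ b * z ^ a))"
proof -
  have *: "0 \<le> (y - z) * (y ^ a * z ^ b - y ^ b * z ^ a)" if "b \<le> a" for a b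
  proof -
    from that obtain d where a: "a = b + d" by (metis le_add_diff_inverse)
    have "(y - z) * (y ^ a * z ^ b - y ^ b * z ^ a) = (y * z) ^ b * ((y - z) * (y ^ d - z ^ d))"
      by (simp add: a power_add power_mult_distrib algebra_simps)
    also have "0 \<le> (y - z) * (y ^ d - z ^ d)"
      using assms power_mono[of y z d] power_mono[of z y d]
      by (cases "y \<le> z") (auto intro: mult_nonneg_nonneg mult_nonpos_nonpos)
    then have "0 \<le> (y * z) ^ b * ((y - z) * (y ^ d - z ^ d))"
      using assms by simp
    finally show ?thesis .
  qed
  show ?thesis
  proof (cases "b \<le> a")
    case True
    have "0 \<le> (real a - real b) * ((y - z) * (y ^ a * z ^ b - y ^ b * z ^ a))"
      using True *[OF True] by simp
    then show ?thesis by (simp add: algebra_simps)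
  next
    case False
    then have "0 \<le> (real b - real a) * ((y - z) * (y ^ b * z ^ a - y ^ a * z ^ b))"
      using *[of a b] by simp
    then show ?thesis by (simp add: algebra_simps)
  qed
qed

lemma swap_term_nonneg:
  assumes "w \<in> words I m" "i \<in> I" "j \<in> I" and x: "\<And>k. k \<in> I \<Longrightarrow> 0 \<le> x k"
  shows "0 \<le> (x i - x j) * swap_term x i j w"
proof -
  have "0 \<le> word_prob x (filter (\<lambda>k. k \<noteq> i \<and> k \<noteq> j) w) / card (set w)"
    using assms by (intro divide_nonneg_nonneg word_prob_nonneg) (auto simp: words_def)
  from mult_nonneg_nonneg[OF this diff_mult_diff_power_nonneg[of "x i" "x j" "count_list w i" "count_list w j"]] assms
  show ?thesis
    by (simp add: swap_term_def mult.left_commute)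
qed

lemma pair_bias_nonneg:
  assumes I: "i \<in> I" "j \<in> I" and x: "\<And>k. k \<in> I \<Longrightarrow> 0 \<le> x k"
  shows "0 \<le> (x i - x j) * pair_bias I m x i j"
proof (cases "i = j")
  case False
  have "0 \<le> (x i - x j) * (2 * pair_bias I m x i j)"
    unfolding pair_bias_symmetrized[OF I False] sum_distrib_left
    by (intro sum_nonneg swap_term_nonneg[OF _ I x])
  then show ?thesis by simp
qed simp

text \<open>
  For \<open>m = 2\<close> the pair bias vanishes; from three draws on, words in which one of the types \<open>i\<close>,
  \<open>j\<close> occurs once and all other letters are the other type contribute.
\<close>

lemma pair_bias_lower_bound:
  assumes I: "finite I" "i \<in> I" "j \<in> I" and x: "\<And>k. k \<in> I \<Longrightarrow> 0 \<le> x k"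
    and m: "m \<ge> 3" and le: "x j \<le> x i"
  shows "x i * x j * x i ^ (m - 3) * (x i - x j)\<^sup>2 \<le> 4 * ((x i - x j) * pair_bias I m x i j)"
proof (cases "i = j")
  case False
  let ?T = "\<lambda>w. (x i - x j) * swap_term x i j w"
  \<comment> \<open>All words contribute with the same sign, so a single one gives a lower bound.\<close>
  define w where "w = i # replicate (m - 1) j"
  have w: "w \<in> words I m"
    using I m by (auto simp: w_def words_def)
  obtain k where k: "m = k + 3" using m by (metis le_add_diff_inverse2)
  have "count_list (replicate n j) k = (if k = j then n else 0)" for n k
    by (induction n) auto
  then have "filter (\<lambda>k. k \<noteq> i \<and> k \<noteq> j) w = []" "set w = {i, j}" "count_list w i = 1" "count_list w j = m - 1"
    using False m by (auto simp: w_def count_list_0_iff filter_empty_conv)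
  then have Tw: "2 * ?T w = (x i - x j) * ((1 - real (k + 2)) *
      (x i * (x j * x j * x j ^ k) - x i * x i * x i ^ k * x j))"
    using False by (simp add: swap_term_def word_prob_def k)
  have "x i ^ k * (x i - x j)\<^sup>2 \<le> (x i - x j) * (x i ^ Suc k - x j ^ Suc k)"
  proof -
    have "x j ^ k \<le> x i ^ k" using le x I by (intro power_mono) auto
    then have "x i ^ k * (x i - x j) \<le> x i ^ Suc k - x j ^ Suc k"
      using x I by (simp add: algebra_simps mult_left_mono)
    then have "(x i - x j) * (x i ^ k * (x i - x j)) \<le> (x i - x j) * (x i ^ Suc k - x j ^ Suc k)"
      using le by (intro mult_left_mono) auto
    then show ?thesis by (simp add: power2_eq_square algebra_simps)
  qed
  then have "x i * x j * (x i ^ k * (x i - x j)\<^sup>2) \<le> x i * x j * ((x i - x j) * (x i ^ Suc k - x j ^ Suc k))"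
    using x I by (intro mult_left_mono) auto
  also have "\<dots> \<le> (1 + real k) * (x i * x j * ((x i - x j) * (x i ^ Suc k - x j ^ Suc k)))"
  proof -
    have "0 \<le> x i * x j * ((x i - x j) * (x i ^ Suc k - x j ^ Suc k))"
      using x I le by (intro mult_nonneg_nonneg) (auto intro!: power_mono mult_mono)
    from mult_right_mono[OF _ this, of 1 "1 + real k"] show ?thesis by simp
  qed
  also have "\<dots> = 2 * ?T w"
    unfolding Tw by (simp add: algebra_simps)
  also have "?T w \<le> (\<Sum>w\<in>words I m. ?T w)"
    using w I x by (intro member_le_sum finite_words swap_term_nonneg) auto
  also have "(\<Sum>w\<in>words I m. ?T w) = (x i - x j) * (2 * pair_bias I m x i j)"
    unfolding pair_bias_symmetrized[OF I(2,3) False] sum_distrib_left ..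
  finally show ?thesis by (simp add: k mult.assoc)
qed simp

lemma pair_bias_Lipschitz:
  assumes I: "finite I" "i \<in> I" "j \<in> I" and x: "\<And>k. k \<in> I \<Longrightarrow> 0 \<le> x k \<and> x k \<le> 1"
  shows "\<bar>pair_bias I m x i j\<bar> \<le> card (words I m) * (real m)\<^sup>2 * \<bar>x i - x j\<bar>"
proof (cases "i = j")
  case False
  have pw: "\<bar>y ^ a * z ^ b - y ^ b * z ^ a\<bar> \<le> real m * \<bar>y - z\<bar>"
    if "0 \<le> y" "y \<le> 1" "0 \<le> z" "z \<le> 1" "b \<le> a" "a \<le> m" for y z :: real and a b
  proof -
    from \<open>b \<le> a\<close> obtain d where a: "a = b + d" by (metis le_add_diff_inverse)
    have "\<bar>y ^ a * z ^ b - y ^ b * z ^ a\<bar> = (y * z) ^ b * \<bar>y ^ d - z ^ d\<bar>"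
    proof -
      have "y ^ a * z ^ b - y ^ b * z ^ a = (y * z) ^ b * (y ^ d - z ^ d)"
        by (simp add: a power_add power_mult_distrib algebra_simps)
      then show ?thesis
        using that by (simp add: abs_mult)
    qed
    also have "\<dots> \<le> 1 * \<bar>y ^ d - z ^ d\<bar>"
      using that by (intro mult_right_mono power_le_one mult_le_one) auto
    also have "\<dots> \<le> real d * \<bar>y - z\<bar>"
      using norm_power_diff[of y z d] that by simp
    also have "\<dots> \<le> real m * \<bar>y - z\<bar>"
      using that a by (intro mult_right_mono) auto
    finally show ?thesis .
  qed
  let ?T = "swap_term x i j"
  have T: "\<bar>?T w\<bar> \<le> (real m)\<^sup>2 * \<bar>x i - x j\<bar>" if w: "w \<in> words I m" for w
  proof (cases "i \<in> set w \<and> j \<in> set w")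
    case True
    let ?a = "count_list w i" and ?b = "count_list w j"
    have ab: "?a \<le> m" "?b \<le> m"
      using w by (auto simp: words_def intro: count_le_length)
    have c: "1 \<le> card (set w)" using True by (cases w) (auto simp: Suc_le_eq card_gt_0_iff)
    have p: "0 \<le> word_prob x (filter (\<lambda>k. k \<noteq> i \<and> k \<noteq> j) w)"
      using w x by (intro word_prob_nonneg) (auto simp: words_def)
    have "word_prob x (filter (\<lambda>k. k \<noteq> i \<and> k \<noteq> j) w) \<le> 1"
      using w x by (intro word_prob_le_1) (auto simp: words_def)
    then have 1: "word_prob x (filter (\<lambda>k. k \<noteq> i \<and> k \<noteq> j) w) / card (set w) \<le> 1"
      using c by (simp add: divide_le_eq)
    have 2: "\<bar>real ?a - real ?b\<bar> \<le> m" using ab by auto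
    have 3: "\<bar>x i ^ ?a * x j ^ ?b - x i ^ ?b * x j ^ ?a\<bar> \<le> m * \<bar>x i - x j\<bar>"
    proof (cases "?b \<le> ?a")
      case True
      then show ?thesis using pw[of "x i" "x j" ?b ?a] x I ab by simp
    next
      case False
      then show ?thesis using pw[of "x i" "x j" ?a ?b] x I ab by (simp add: abs_minus_commute)
    qed
    have "\<bar>?T w\<bar> = word_prob x (filter (\<lambda>k. k \<noteq> i \<and> k \<noteq> j) w) / card (set w) *
        (\<bar>real ?a - real ?b\<bar> * \<bar>x i ^ ?a * x j ^ ?b - x i ^ ?b * x j ^ ?a\<bar>)"
      using True p by (simp add: swap_term_def abs_mult)
    also have "\<dots> \<le> 1 * (real m * (real m * \<bar>x i - x j\<bar>))"
      using p by (intro mult_mono 1 2 3) auto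
    finally show ?thesis by (simp add: power2_eq_square)
  qed (auto simp: swap_term_def)
  have "2 * \<bar>pair_bias I m x i j\<bar> = \<bar>\<Sum>w\<in>words I m. ?T w\<bar>"
    unfolding pair_bias_symmetrized[OF I(2,3) False, symmetric] by simp
  also have "\<dots> \<le> (\<Sum>w\<in>words I m. (real m)\<^sup>2 * \<bar>x i - x j\<bar>)"
    by (rule order_trans[OF sum_abs sum_mono[OF T]])
  also have "\<dots> = card (words I m) * (real m)\<^sup>2 * \<bar>x i - x j\<bar>"
    by simp
  finally show ?thesis by linarith
next
  case True
  have "pair_bias I m x i i = - pair_bias I m x i i"
    by (rule pair_bias_antisym)
  then show ?thesis using True by simp
qed

text \<open>
  The key inequality: the relative drift \<open>(p i - x i) / x i\<close>, summed over all types, is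
  nonnegative and vanishes only at the uniform distribution. By antisymmetry the sum is
  \<open>1 / (2 * m)\<close> times the double sum of \<open>pair_bias I m x i j * (x i - x j) / (x i * x j)\<close>; the
  terms are nonnegative, and those in the row of a largest share give the bound.
\<close>

lemma adopt_prob_drift:
  assumes I: "finite I" and m: "m \<ge> 3"
    and x: "\<And>k. k \<in> I \<Longrightarrow> 0 < x k" and sum1: "sum x I = 1"
  shows "(\<Sum>i\<in>I. (x i - 1 / card I)\<^sup>2) / (8 * real m * real (card I) ^ (m - 3))
    \<le> (\<Sum>i\<in>I. (adopt_prob I m x i - x i) / x i)"
proof -
  define N where "N = card I"
  have ne: "I \<noteq> {}" using sum1 by auto
  then have N: "N > 0" using I by (simp add: N_def card_gt_0_iff)
  define F where "F = pair_bias I m x"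
  have x0: "0 \<le> x k" if "k \<in> I" for k using x[OF that] by simp
  \<comment> \<open>A type \<open>M\<close> with the largest share has share at least \<open>1 / N\<close>, which bounds the power in
     \<open>pair_bias_lower_bound\<close> from below independently of \<open>x\<close>.\<close>
  obtain M where M: "M \<in> I" "\<And>j. j \<in> I \<Longrightarrow> x j \<le> x M"
  proof -
    have "Max (x ` I) \<in> x ` I" using I ne by (intro Max_in) auto
    then obtain M where "M \<in> I" "x M = Max (x ` I)" by auto
    then show ?thesis using that[of M] I by auto
  qed
  have "1 \<le> N * x M"
    using sum_bounded_above[of I x "x M"] M sum1 by (simp add: N_def)
  then have xM: "1 / N \<le> x M" using N by (simp add: field_simps)
  have nn: "0 \<le> F i j * (x i - x j) / (x i * x j)" if "i \<in> I" "j \<in> I" for i j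
    using pair_bias_nonneg[where m = m, OF that x0] x that by (auto simp: F_def mult.commute intro!: divide_nonneg_pos)
  have lower: "(x M - x j)\<^sup>2 / (4 * real N ^ (m - 3)) \<le> F M j * (x M - x j) / (x M * x j)" if j: "j \<in> I" for j
  proof -
    have "(1 / N) ^ (m - 3) * (x M - x j)\<^sup>2 \<le> x M ^ (m - 3) * (x M - x j)\<^sup>2"
      using xM by (intro mult_right_mono power_mono) auto
    moreover have "x M * x j * (x M ^ (m - 3) * (x M - x j)\<^sup>2) \<le> 4 * ((x M - x j) * F M j)"
      using pair_bias_lower_bound[OF I M(1) j x0 m M(2)[OF j]] by (simp add: F_def mult.assoc)
    then have "x M ^ (m - 3) * (x M - x j)\<^sup>2 \<le> 4 * (F M j * (x M - x j) / (x M * x j))"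
      using x[OF M(1)] x[OF j] by (simp add: field_simps)
    ultimately have "(1 / N) ^ (m - 3) * (x M - x j)\<^sup>2 \<le> 4 * (F M j * (x M - x j) / (x M * x j))"
      by (rule order_trans)
    moreover have "(x M - x j)\<^sup>2 / (4 * real N ^ (m - 3)) = (1 / N) ^ (m - 3) * (x M - x j)\<^sup>2 / 4"
      by (simp add: power_divide)
    ultimately show ?thesis by linarith
  qed
  \<comment> \<open>The sum of squared distances to a point is smallest for the mean \<open>1 / N\<close>.\<close>
  define c where "c = 1 / real N"
  have "(\<Sum>j\<in>I. (x M - x j)\<^sup>2) - (\<Sum>j\<in>I. (x j - c)\<^sup>2) = (\<Sum>j\<in>I. (x M - c) * ((x M + c) - 2 * x j))"
    unfolding sum_subtractf[symmetric] by (intro sum.cong refl) (simp add: power2_eq_square algebra_simps)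
  also have "\<dots> = (x M - c) * (N * (x M + c) - 2)"
    by (simp add: sum_subtractf sum1 N_def flip: sum_distrib_left)
  also have "\<dots> = (x M - c) * (N * x M - 1)"
    using N by (simp add: c_def distrib_left)
  also have "0 \<le> \<dots>"
    using xM \<open>1 \<le> N * x M\<close> by (simp add: c_def)
  finally have "(\<Sum>i\<in>I. (x i - 1 / N)\<^sup>2) \<le> (\<Sum>j\<in>I. (x M - x j)\<^sup>2)"
    by (simp add: c_def)
  then have "(\<Sum>i\<in>I. (x i - 1 / N)\<^sup>2) / (4 * real N ^ (m - 3)) \<le>
      (\<Sum>j\<in>I. (x M - x j)\<^sup>2) / (4 * real N ^ (m - 3))"
    by (intro divide_right_mono) auto
  also have "\<dots> \<le> (\<Sum>j\<in>I. F M j * (x M - x j) / (x M * x j))"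
    unfolding sum_divide_distrib by (intro sum_mono lower)
  also have "\<dots> \<le> (\<Sum>i\<in>I. \<Sum>j\<in>I. F i j * (x i - x j) / (x i * x j))"
    using I M nn by (intro member_le_sum[of M I "\<lambda>i. \<Sum>j\<in>I. F i j * (x i - x j) / (x i * x j)"] sum_nonneg) auto
  also have "\<dots> = (\<Sum>i\<in>I. \<Sum>j\<in>I. F i j / x j - F i j / x i)"
  proof (intro sum.cong refl)
    fix i j assume "i \<in> I" "j \<in> I"
    then have "x i \<noteq> 0" "x j \<noteq> 0" using x by fastforce+
    then show "F i j * (x i - x j) / (x i * x j) = F i j / x j - F i j / x i"
      by (simp add: field_simps)
  qed
  also have "\<dots> = (\<Sum>i\<in>I. \<Sum>j\<in>I. F i j / x j) - (\<Sum>i\<in>I. \<Sum>j\<in>I. F i j / x i)"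
    by (simp add: sum_subtractf)
  also have "(\<Sum>i\<in>I. \<Sum>j\<in>I. F i j / x j) = (\<Sum>j\<in>I. \<Sum>i\<in>I. F i j / x j)"
    by (rule sum.swap)
  also have "\<dots> = (\<Sum>i\<in>I. \<Sum>j\<in>I. - F i j / x i)"
    by (intro sum.cong refl arg_cong2[where f = "(/)"]) (unfold F_def, rule pair_bias_antisym)
  also have "\<dots> - (\<Sum>i\<in>I. \<Sum>j\<in>I. F i j / x i) = - 2 * (\<Sum>i\<in>I. (\<Sum>j\<in>I. F i j) / x i)"
    by (simp add: sum_negf sum_divide_distrib)
  also have "\<dots> = (\<Sum>i\<in>I. 2 * m * ((adopt_prob I m x i - x i) / x i))"
    unfolding sum_distrib_left
    by (intro sum.cong refl) (simp add: F_def sum_pair_bias[OF I sum1] algebra_simps diff_divide_distrib)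
  also have "\<dots> = 2 * m * (\<Sum>i\<in>I. (adopt_prob I m x i - x i) / x i)"
    by (simp add: sum_distrib_left)
  finally have "(\<Sum>i\<in>I. (x i - 1 / N)\<^sup>2) / (4 * real N ^ (m - 3)) / (2 * m) \<le>
      (\<Sum>i\<in>I. (adopt_prob I m x i - x i) / x i)"
    using m by (subst pos_divide_le_eq) (auto simp: mult.commute)
  then show ?thesis
    by (simp add: N_def mult.commute mult.left_commute)
qed

text \<open>
  The drift vanishes at the uniform distribution, and it does so at least linearly.
\<close>

lemma adopt_prob_Lipschitz:
  assumes I: "finite I"
    and x: "\<And>k. k \<in> I \<Longrightarrow> 0 \<le> x k" and sum1: "sum x I = 1" and i: "i \<in> I"
  shows "(real m * (x i - adopt_prob I m x i))\<^sup>2 \<le>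
    (2 * card I * card (words I m) * (real m)\<^sup>2)\<^sup>2 * (\<Sum>j\<in>I. (x j - 1 / card I)\<^sup>2)"
proof -
  define s where "s = (\<Sum>j\<in>I. (x j - 1 / card I)\<^sup>2)"
  have s0: "0 \<le> s" by (simp add: s_def sum_nonneg)
  have x1: "x k \<le> 1" if "k \<in> I" for k
    using member_le_sum[of k I x] that x I sum1 by auto
  have dev: "\<bar>x j - 1 / card I\<bar> \<le> sqrt s" if "j \<in> I" for j
  proof -
    have "(x j - 1 / card I)\<^sup>2 \<le> s"
      unfolding s_def using that I by (intro member_le_sum) auto
    then show ?thesis by (simp add: real_le_rsqrt abs_le_square_iff[symmetric] real_sqrt_le_iff flip: real_sqrt_abs)
  qed
  define c where "c = card (words I m) * (real m)\<^sup>2"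
  have "real m * (x i - adopt_prob I m x i) = (\<Sum>j\<in>I. pair_bias I m x i j)"
    by (simp add: sum_pair_bias[OF I sum1 i] algebra_simps)
  then have "\<bar>real m * (x i - adopt_prob I m x i)\<bar> \<le> (\<Sum>j\<in>I. \<bar>pair_bias I m x i j\<bar>)"
    by (simp add: sum_abs)
  also have "\<dots> \<le> (\<Sum>j\<in>I. c * (2 * sqrt s))"
  proof (rule sum_mono)
    fix j assume j: "j \<in> I"
    have "\<bar>pair_bias I m x i j\<bar> \<le> c * \<bar>x i - x j\<bar>"
      unfolding c_def using pair_bias_Lipschitz[OF I i j] x x1 by blast
    also have "\<dots> \<le> c * (2 * sqrt s)"
      using dev[OF i] dev[OF j] by (intro mult_left_mono) (auto simp: c_def)
    finally show "\<bar>pair_bias I m x i j\<bar> \<le> c * (2 * sqrt s)" .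
  qed
  also have "\<dots> = 2 * card I * c * sqrt s" by simp
  finally have "\<bar>real m * (x i - adopt_prob I m x i)\<bar>\<^sup>2 \<le> (2 * card I * c * sqrt s)\<^sup>2"
    by (intro power_mono) auto
  also have "\<dots> = (2 * card I * c)\<^sup>2 * s"
    using s0 by (simp add: power_mult_distrib)
  finally show ?thesis
    by (simp add: c_def s_def mult.assoc)
qed

section \<open>Degrees and types after the arrival of a vertex\<close>

lemma countable_UNIV_tgraph: "countable (UNIV :: tgraph set)"
proof -
  have "g \<in> range (\<lambda>(ts, ps). TGraph ts (mset (map (\<lambda>(a, b). Upair a b) ps)))" for g
  proof -
    have up: "(\<lambda>(a, b). Upair a b) (SOME p. (\<lambda>(a, b). Upair a b) p = e) = e" for e :: "nat uprod"
      by (rule someI_ex, cases e) auto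
    obtain es where es: "mset es = edges g" using ex_mset by blast
    let ?ps = "map (\<lambda>e. SOME p. (\<lambda>(a, b). Upair a b) p = e) es"
    have "map (\<lambda>(a, b). Upair a b) ?ps = es"
      by (simp add: up o_def)
    then have "g = (\<lambda>(ts, ps). TGraph ts (mset (map (\<lambda>(a, b). Upair a b) ps))) (types g, ?ps)"
      using es by (cases g) (simp del: mset_map)
    then show ?thesis by blast
  qed
  then have "(UNIV :: tgraph set) = range (\<lambda>(ts, ps). TGraph ts (mset (map (\<lambda>(a, b). Upair a b) ps)))"
    by blast
  then show ?thesis
    by (metis countableI_type countable_image)
qed

instance tgraph :: countable
  by standard (rule exI[of _ "to_nat_on UNIV"], rule inj_on_to_nat_on, rule countable_UNIV_tgraph)

lemma length_types_add_vertex [simp]: "length (types (add_vertex g t vs)) = Suc (length (types g))"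
  by (simp add: add_vertex_def)

lemma verts_add_vertex: "verts (add_vertex g t vs) = insert (length (types g)) (verts g)"
  by (auto simp: verts_def add_vertex_def)

lemma finite_verts [simp]: "finite (verts g)"
  by (simp add: verts_def)

lemma new_vertex_notin [simp]: "length (types g) \<notin> verts g"
  by (simp add: verts_def)

lemma type_of_add_vertex:
  "v \<in> verts g \<Longrightarrow> type_of (add_vertex g t vs) v = type_of g v"
  "type_of (add_vertex g t vs) (length (types g)) = t"
  by (auto simp: verts_def type_of_def add_vertex_def nth_append)

lemma size_filter_mset_mset: "size {#x \<in># mset xs. P x#} = length (filter P xs)"
  by (metis mset_filter size_mset)

lemma degree_add_vertex_old:
  assumes v: "v \<in> verts g" and vs: "set vs \<subseteq> verts g"
  shows "degree (add_vertex g t vs) v = degree g v + count_list vs v"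
proof -
  have ne: "v \<noteq> length (types g)" using v by auto
  have "size {#e \<in># mset (map (Upair (length (types g))) vs). v \<in> set_uprod e#} = count_list vs v"
    unfolding size_filter_mset_mset using ne by (induction vs) auto
  moreover have "count (mset (map (Upair (length (types g))) vs)) (Upair v v) = 0"
    using ne by (auto simp del: mset_map simp: count_eq_zero_iff)
  ultimately show ?thesis
    by (simp add: degree_def add_vertex_def del: mset_map)
qed

lemma degree_add_vertex_new:
  assumes g: "typed_graph N g" and vs: "set vs \<subseteq> verts g"
  shows "degree (add_vertex g t vs) (length (types g)) = length vs"
proof -
  let ?n = "length (types g)"
  have old: "?n \<notin> set_uprod e" if "e \<in># edges g" for e
    using g that by (auto simp: typed_graph_def dest!: bspec[of _ _ e])
  then have 1: "{#e \<in># edges g. ?n \<in> set_uprod e#} = {#}"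
    by simp
  have 2: "count (edges g) (Upair ?n ?n) = 0"
    using old[of "Upair ?n ?n"] by (auto simp: count_eq_zero_iff)
  have 3: "size {#e \<in># mset (map (Upair ?n) vs). ?n \<in> set_uprod e#} = length vs"
    unfolding size_filter_mset_mset by (induction vs) auto
  have 4: "count (mset (map (Upair ?n) vs)) (Upair ?n ?n) = 0"
    using vs by (auto simp del: mset_map simp: count_eq_zero_iff)
  show ?thesis
    using 1 2 3 4 by (simp add: degree_def add_vertex_def del: mset_map)
qed

lemma sum_count_list_type:
  assumes "set vs \<subseteq> A" "finite A"
  shows "(\<Sum>v\<in>{v\<in>A. f v = j}. count_list vs v) = count_list (map f vs) j"
  using assms(1)
proof (induction vs)
  case (Cons a vs)
  have "(\<Sum>v\<in>{v\<in>A. f v = j}. count_list (a # vs) v) =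
    (\<Sum>v\<in>{v\<in>A. f v = j}. count_list vs v + (if a = v then 1 else 0))"
    by (intro sum.cong) auto
  also have "\<dots> = count_list (map f vs) j + (if f a = j then 1 else 0)"
    using Cons assms(2) by (simp add: sum.distrib)
  finally show ?case by simp
qed simp

lemma type_degree_add_vertex:
  assumes g: "typed_graph N g" and vs: "set vs \<subseteq> verts g"
  shows "type_degree (add_vertex g t vs) j =
    type_degree g j + count_list (map (type_of g) vs) j + (if t = j then length vs else 0)"
proof -
  let ?g = "add_vertex g t vs" and ?n = "length (types g)"
  let ?A = "{v \<in> verts g. type_of g v = j}"
  have "{v \<in> verts ?g. type_of ?g v = j} = ?A \<union> (if t = j then {?n} else {})"
    by (auto simp: verts_add_vertex type_of_add_vertex)
  then have "type_degree ?g j = (\<Sum>v\<in>?A. degree ?g v) + (if t = j then degree ?g ?n else 0)"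
    by (auto simp: type_degree_def sum.insert)
  also have "(\<Sum>v\<in>?A. degree ?g v) = (\<Sum>v\<in>?A. degree g v + count_list vs v)"
    using degree_add_vertex_old[OF _ vs] by (intro sum.cong) auto
  also have "\<dots> = type_degree g j + count_list (map (type_of g) vs) j"
    using sum_count_list_type[OF vs finite_verts] by (simp add: sum.distrib type_degree_def)
  finally show ?thesis
    using degree_add_vertex_new[OF g vs] by simp
qed

lemma total_degree_eq_sum_type_degree:
  assumes "typed_graph N g"
  shows "total_degree g = (\<Sum>j=1..N. type_degree g j)"
proof -
  have "total_degree g = (\<Sum>j\<in>{1..N}. \<Sum>v\<in>{v \<in> verts g. type_of g v = j}. degree g v)"
    unfolding total_degree_def using assms by (intro sum.group[symmetric]) (auto simp: typed_graph_def)
  then show ?thesis by (simp add: type_degree_def)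
qed

lemma total_degree_add_vertex:
  assumes g: "typed_graph N g" and vs: "set vs \<subseteq> verts g"
  shows "total_degree (add_vertex g t vs) = total_degree g + 2 * length vs"
proof -
  have "(\<Sum>v\<in>verts g. degree (add_vertex g t vs) v) = (\<Sum>v\<in>verts g. degree g v + count_list vs v)"
    using degree_add_vertex_old[OF _ vs] by (intro sum.cong) auto
  also have "\<dots> = total_degree g + length vs"
    using sum_count_list[OF finite_verts vs] by (simp add: sum.distrib total_degree_def)
  finally show ?thesis
    using degree_add_vertex_new[OF g vs] by (simp add: total_degree_def verts_add_vertex)
qed

lemma typed_graph_add_vertex:
  assumes "typed_graph N g" and "set vs \<subseteq> verts g" and "t \<in> {1..N}"
  shows "typed_graph N (add_vertex g t vs)"
proof -
  have "edges (add_vertex g t vs) = edges g + mset (map (Upair (length (types g))) vs)"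
    by (simp add: add_vertex_def)
  then show ?thesis
    using assms unfolding typed_graph_def
    by (auto simp: verts_add_vertex type_of_add_vertex)
qed

text \<open>
  The number of vertices of type \<open>j\<close>.
\<close>

definition type_count :: "tgraph \<Rightarrow> nat \<Rightarrow> nat" where
  "type_count g j = card {v\<in>verts g. type_of g v = j}"

lemma type_count_add_vertex:
  "type_count (add_vertex g t vs) j = type_count g j + (if t = j then 1 else 0)"
proof -
  have "{v \<in> verts (add_vertex g t vs). type_of (add_vertex g t vs) v = j} =
    (if t = j then insert (length (types g)) {v \<in> verts g. type_of g v = j} else {v \<in> verts g. type_of g v = j})"
    by (auto simp: verts_add_vertex type_of_add_vertex)
  then show ?thesis by (simp add: type_count_def)
qed

section \<open>The law of one step\<close>

text \<open>The proportion of the total degree that the vertices of type \<open>j\<close> carry.\<close>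

definition type_share :: "tgraph \<Rightarrow> nat \<Rightarrow> real" where
  "type_share g j = real (type_degree g j) / real (total_degree g)"

text \<open>
  The invariant of the process: a well-formed typed graph in which each type has positive total
  degree.
\<close>

definition all_types_present :: "nat \<Rightarrow> tgraph \<Rightarrow> bool" where
  "all_types_present N g \<longleftrightarrow> typed_graph N g \<and> (\<forall>j\<in>{1..N}. 0 < type_degree g j)"

lemma total_degree_pos:
  assumes "all_types_present N g" "1 \<le> N"
  shows "0 < total_degree g"
proof -
  have "type_degree g 1 \<le> (\<Sum>j=1..N. type_degree g j)"
    using assms(2) by (intro member_le_sum) auto
  then show ?thesis
    using assms total_degree_eq_sum_type_degree[of N g] by (force simp: all_types_present_def)
qed

lemma pmf_replicate_pmf:
  "pmf (replicate_pmf n p) xs = (if length xs = n then prod_list (map (pmf p) xs) else 0)"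
proof (induction n arbitrary: xs)
  case (Suc n)
  show ?case
  proof (cases xs)
    case Nil
    have "[] \<notin> set_pmf (replicate_pmf (Suc n) p)" by auto
    then show ?thesis using Nil by (simp add: pmf_eq_0_set_pmf del: replicate_pmf.simps)
  next
    case (Cons a ys)
    have "pmf (replicate_pmf n p \<bind> (\<lambda>zs. return_pmf (b # zs))) xs =
      indicator {a} b * pmf (replicate_pmf n p) ys" for b
    proof (cases "b = a")
      case True
      have "inj ((#) a)" by (auto intro: injI)
      from pmf_map_inj'[OF this, of "replicate_pmf n p" ys] True show ?thesis
        by (simp add: map_pmf_def Cons)
    next
      case False
      have "xs \<notin> set_pmf (replicate_pmf n p \<bind> (\<lambda>zs. return_pmf (b # zs)))"
        using False Cons by auto
      then show ?thesis using False by (simp add: pmf_eq_0_set_pmf)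
    qed
    then show ?thesis
      by (simp add: pmf_bind[of p] measure_pmf_single Suc.IH Cons)
  qed
qed (auto simp: indicator_def)

lemma replicate_pmf_map: "replicate_pmf n (map_pmf f p) = map_pmf (map f) (replicate_pmf n p)"
  by (induction n) (simp_all add: map_bind_pmf bind_map_pmf)

lemma expectation_replicate_pmf:
  fixes f :: "'b list \<Rightarrow> real"
  assumes "finite I" "set_pmf p \<subseteq> I"
  shows "measure_pmf.expectation (replicate_pmf m p) f = (\<Sum>w\<in>words I m. word_prob (pmf p) w * f w)"
proof -
  have "measure_pmf.expectation (replicate_pmf m p) f = (\<Sum>w\<in>words I m. f w * pmf (replicate_pmf m p) w)"
    using assms by (intro integral_measure_pmf_real finite_words) (auto simp: words_def set_replicate_pmf)
  also have "\<dots> = (\<Sum>w\<in>words I m. word_prob (pmf p) w * f w)"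
    by (intro sum.cong refl) (auto simp: pmf_replicate_pmf word_prob_def words_def)
  finally show ?thesis .
qed

lemma set_pmf_degree_biased:
  assumes "0 < total_degree g"
  shows "set_pmf (degree_biased g) \<subseteq> verts g"
  by (auto simp: set_pmf_iff pmf_degree_biased[OF assms] split: if_splits)

lemma pmf_type_degree_biased:
  assumes "0 < total_degree g"
  shows "pmf (map_pmf (type_of g) (degree_biased g)) j = type_share g j"
proof -
  have "pmf (map_pmf (type_of g) (degree_biased g)) j =
      measure_pmf.prob (degree_biased g) {v\<in>verts g. type_of g v = j}"
    unfolding pmf_map using set_pmf_degree_biased[OF assms]
    by (intro measure_pmf.finite_measure_eq_AE) (auto simp: AE_measure_pmf_iff)
  also have "\<dots> = (\<Sum>v\<in>{v\<in>verts g. type_of g v = j}. pmf (degree_biased g) v)"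
    by (intro measure_measure_pmf_finite) auto
  also have "\<dots> = (\<Sum>v\<in>{v\<in>verts g. type_of g v = j}. real (degree g v) / real (total_degree g))"
    by (intro sum.cong) (auto simp: pmf_degree_biased[OF assms])
  finally show ?thesis
    by (simp add: type_share_def type_degree_def sum_divide_distrib)
qed

lemma pa_step_support:
  assumes g: "0 < total_degree g" and m: "1 \<le> m" and h: "h \<in> set_pmf (pa_step m g)"
  obtains vs t where "set vs \<subseteq> verts g" "length vs = m" "t \<in> type_of g ` set vs" "h = add_vertex g t vs"
proof -
  obtain vs t where vs: "vs \<in> set_pmf (replicate_pmf m (degree_biased g))"
    and t: "t \<in> set_pmf (pmf_of_set (type_of g ` set vs))" and h': "h = add_vertex g t vs"
    using h by (auto simp: pa_step_def)
  have 1: "set vs \<subseteq> verts g" "length vs = m"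
    using vs set_pmf_degree_biased[OF g] by (auto simp: set_replicate_pmf)
  then have "type_of g ` set vs \<noteq> {}" using m by auto
  then have "t \<in> type_of g ` set vs" using t by (simp add: set_pmf_of_set)
  with 1 h' that show ?thesis by blast
qed

lemma finite_set_pmf_pa_step:
  assumes g: "0 < total_degree g" and m: "1 \<le> m"
  shows "finite (set_pmf (pa_step m g))"
proof (rule finite_subset)
  show "set_pmf (pa_step m g) \<subseteq> (\<lambda>(t, vs). add_vertex g t vs) ` ((type_of g ` verts g) \<times> words (verts g) m)"
  proof
    fix h assume "h \<in> set_pmf (pa_step m g)"
    then obtain vs t where "set vs \<subseteq> verts g" "length vs = m" "t \<in> type_of g ` set vs" "h = add_vertex g t vs"
      using pa_step_support[OF g m] by metis
    then show "h \<in> (\<lambda>(t, vs). add_vertex g t vs) ` ((type_of g ` verts g) \<times> words (verts g) m)"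
      by (auto simp: words_def intro!: image_eqI[of _ _ "(t, vs)"])
  qed
  show "finite ((\<lambda>(t, vs). add_vertex g t vs) ` ((type_of g ` verts g) \<times> words (verts g) m))"
    by (intro finite_imageI finite_cartesian_product finite_words) auto
qed

lemma all_types_present_pa_step:
  assumes g: "all_types_present N g" and N: "1 \<le> N" and m: "1 \<le> m" and h: "h \<in> set_pmf (pa_step m g)"
  shows "all_types_present N h" "total_degree h = total_degree g + 2 * m"
    "length (types h) = Suc (length (types g))"
proof -
  have tg: "typed_graph N g" using g by (simp add: all_types_present_def)
  obtain vs t where vs: "set vs \<subseteq> verts g" "length vs = m" "t \<in> type_of g ` set vs" "h = add_vertex g t vs"
    using pa_step_support[OF total_degree_pos[OF g N] m h] by metis
  then have "t \<in> {1..N}" using tg by (auto simp: typed_graph_def)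
  then show "all_types_present N h"
    using g vs typed_graph_add_vertex[OF tg vs(1)] type_degree_add_vertex[OF tg vs(1)]
    by (auto simp: all_types_present_def)
  show "total_degree h = total_degree g + 2 * m"
    using total_degree_add_vertex[OF tg vs(1)] vs by simp
  show "length (types h) = Suc (length (types g))"
    using vs by simp
qed

text \<open>
  The mean of \<open>f w t\<close> when \<open>w\<close> is a sample of size \<open>m\<close> and \<open>t\<close> is uniform on the set of types that
  occur in \<open>w\<close>.
\<close>

definition step_mean :: "'b set \<Rightarrow> nat \<Rightarrow> ('b \<Rightarrow> real) \<Rightarrow> ('b list \<Rightarrow> 'b \<Rightarrow> real) \<Rightarrow> real" where
  "step_mean I m x f = (\<Sum>w\<in>words I m. word_prob x w * ((\<Sum>t\<in>set w. f w t) / card (set w)))"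

lemma step_mean_add: "step_mean I m x (\<lambda>w t. f w t + g w t) = step_mean I m x f + step_mean I m x g"
  by (simp add: step_mean_def sum.distrib add_divide_distrib distrib_left)

lemma step_mean_diff: "step_mean I m x (\<lambda>w t. f w t - g w t) = step_mean I m x f - step_mean I m x g"
  by (simp add: step_mean_def sum_subtractf diff_divide_distrib right_diff_distrib)

lemma step_mean_cmult: "step_mean I m x (\<lambda>w t. c * f w t) = c * step_mean I m x f"
  unfolding step_mean_def sum_distrib_left[symmetric] times_divide_eq_right[symmetric]
  by (simp add: sum_distrib_left mult.left_commute)

lemma step_mean_sum: "step_mean I m x (\<lambda>w t. \<Sum>j\<in>J. f j w t) = (\<Sum>j\<in>J. step_mean I m x (f j))"
proof (cases "finite J")
  case True
  then show ?thesis
  proof (induction J)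
    case empty
    then show ?case by (simp add: step_mean_def)
  next
    case (insert a J)
    then show ?case by (simp add: step_mean_add)
  qed
qed (simp add: step_mean_def)

lemma step_mean_of_word:
  assumes "1 \<le> m"
  shows "step_mean I m x (\<lambda>w t. f w) = (\<Sum>w\<in>words I m. word_prob x w * f w)"
  unfolding step_mean_def
proof (intro sum.cong refl)
  fix w assume "w \<in> words I m"
  then have "set w \<noteq> {}" using assms by (auto simp: words_def)
  then have "card (set w) \<noteq> 0" by simp
  then show "word_prob x w * ((\<Sum>t\<in>set w. f w) / card (set w)) = word_prob x w * f w" by simp
qed

lemma step_mean_const:
  assumes "1 \<le> m" "finite I" "sum x I = 1"
  shows "step_mean I m x (\<lambda>w t. c) = c"
  using step_mean_of_word[OF assms(1), of I x "\<lambda>_. c"] sum_word_prob[OF assms(2,3), of m]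
  by (simp flip: sum_distrib_right)

lemma step_mean_count:
  assumes "1 \<le> m" "finite I" "sum x I = 1" "i \<in> I"
  shows "step_mean I m x (\<lambda>w t. real (count_list w i)) = m * x i"
  using step_mean_of_word[OF assms(1), of I x "\<lambda>w. real (count_list w i)"] sum_word_prob_count[OF assms(2-4), of m]
  by simp

lemma step_mean_adopt: "step_mean I m x (\<lambda>w t. of_bool (t = i)) = adopt_prob I m x i"
  unfolding step_mean_def adopt_prob_def of_bool_def by (intro sum.cong refl) auto

lemma sum_type_share:
  assumes "all_types_present N g" "1 \<le> N"
  shows "(\<Sum>j=1..N. type_share g j) = 1"
proof -
  have "(\<Sum>j=1..N. type_share g j) = real (\<Sum>j=1..N. type_degree g j) / real (total_degree g)"
    by (simp add: type_share_def sum_divide_distrib)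
  also have "(\<Sum>j=1..N. type_degree g j) = total_degree g"
    using assms total_degree_eq_sum_type_degree[of N g] by (simp add: all_types_present_def)
  finally show ?thesis
    using total_degree_pos[OF assms] by simp
qed

lemma type_share_pos:
  assumes "all_types_present N g" "1 \<le> N" "j \<in> {1..N}"
  shows "0 < type_share g j"
  using total_degree_pos[OF assms(1,2)] assms by (simp add: type_share_def all_types_present_def)

text \<open>
  Only the types of the chosen vertices matter, and these are independent with the shares as
  probabilities.
\<close>

lemma expectation_pa_step_le:
  fixes f :: "tgraph \<Rightarrow> real"
  assumes g: "all_types_present N g" and N: "1 \<le> N" and m: "1 \<le> m"
    and le: "\<And>vs t. set vs \<subseteq> verts g \<Longrightarrow> length vs = m \<Longrightarrow> t \<in> type_of g ` set vs \<Longrightarrow>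
      f (add_vertex g t vs) \<le> u (map (type_of g) vs) t"
  shows "measure_pmf.expectation (pa_step m g) f \<le> step_mean {1..N} m (type_share g) u"
proof -
  have pos: "0 < total_degree g" by (rule total_degree_pos[OF g N])
  let ?P = "replicate_pmf m (degree_biased g)"
  define U where "U w = (\<Sum>t\<in>set w. u w t) / card (set w)" for w
  have supp: "set vs \<subseteq> verts g \<and> length vs = m \<and> set vs \<noteq> {}" if "vs \<in> set_pmf ?P" for vs
    using that set_pmf_degree_biased[OF pos] m by (auto simp: set_replicate_pmf)
  have finP: "finite (set_pmf ?P)"
    by (rule finite_subset[OF _ finite_words[OF finite_verts, of g m]]) (use supp in \<open>auto simp: words_def\<close>)
  have fin2: "finite (set_pmf (pmf_of_set (type_of g ` set vs)))" if "vs \<in> set_pmf ?P" for vs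
    using supp[OF that] by simp
  have "measure_pmf.expectation (pa_step m g) f =
      measure_pmf.expectation ?P (\<lambda>vs. measure_pmf.expectation (pmf_of_set (type_of g ` set vs))
        (\<lambda>t. f (add_vertex g t vs)))"
    unfolding pa_step_def
    using finP fin2 by (simp add: expectation_bind_pmf_finite integral_cong_AE AE_measure_pmf_iff)
  also have "\<dots> \<le> measure_pmf.expectation ?P (\<lambda>vs. U (map (type_of g) vs))"
  proof (intro integral_mono_AE integrable_measure_pmf_finite finP)
    show "AE vs in measure_pmf ?P. measure_pmf.expectation (pmf_of_set (type_of g ` set vs))
        (\<lambda>t. f (add_vertex g t vs)) \<le> U (map (type_of g) vs)"
      unfolding AE_measure_pmf_iff
    proof
      fix vs assume vs: "vs \<in> set_pmf ?P"
      have "measure_pmf.expectation (pmf_of_set (type_of g ` set vs)) (\<lambda>t. f (add_vertex g t vs)) =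
        (\<Sum>t\<in>type_of g ` set vs. f (add_vertex g t vs)) / card (type_of g ` set vs)"
        using supp[OF vs] by (intro integral_pmf_of_set) auto
      also have "\<dots> \<le> (\<Sum>t\<in>type_of g ` set vs. u (map (type_of g) vs) t) / card (type_of g ` set vs)"
        using supp[OF vs] by (intro divide_right_mono sum_mono le) auto
      finally show "measure_pmf.expectation (pmf_of_set (type_of g ` set vs)) (\<lambda>t. f (add_vertex g t vs))
          \<le> U (map (type_of g) vs)"
        by (simp add: U_def)
    qed
  qed
  also have "\<dots> = measure_pmf.expectation (replicate_pmf m (map_pmf (type_of g) (degree_biased g))) U"
    by (simp add: replicate_pmf_map)
  also have "\<dots> = (\<Sum>w\<in>words {1..N} m. word_prob (pmf (map_pmf (type_of g) (degree_biased g))) w * U w)"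
  proof (intro expectation_replicate_pmf)
    show "set_pmf (map_pmf (type_of g) (degree_biased g)) \<subseteq> {1..N}"
      using g set_pmf_degree_biased[OF pos] unfolding all_types_present_def typed_graph_def by fastforce
  qed simp
  also have "pmf (map_pmf (type_of g) (degree_biased g)) = type_share g"
    using pmf_type_degree_biased[OF pos] by (intro ext)
  finally show ?thesis by (simp add: step_mean_def U_def)
qed

section \<open>The Lyapunov function\<close>

text \<open>
  In the long run a vertex of type \<open>i\<close> should account for \<open>2 * m\<close> of the degree of its type: \<open>m\<close>
  of its own, and \<open>m\<close> chosen by later vertices. The discrepancy measures the deviation from this,
  relative to the total degree.
\<close>

definition type_discrepancy :: "nat \<Rightarrow> nat \<Rightarrow> tgraph \<Rightarrow> real" where
  "type_discrepancy m i g = (real (type_degree g i) - 2 * m * real (type_count g i)) / real (total_degree g)"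

text \<open>
  The squared distance of the shares from the uniform distribution.
\<close>

definition share_spread :: "nat \<Rightarrow> tgraph \<Rightarrow> real" where
  "share_spread N g = (\<Sum>j=1..N. (type_share g j - 1 / N)\<^sup>2)"

text \<open>
  The summands \<open>2 * m / type_degree g j\<close> and \<open>m / (2 * total_degree g)\<close> compensate the
  second-order terms of the logarithm and of the square of the discrepancy; as the total degree
  grows they tend to \<open>0\<close> when the shares stay away from \<open>0\<close>. The factor \<open>N\<close> in the logarithm makes
  \<open>0\<close> a lower bound.
\<close>

definition Lyapunov :: "nat \<Rightarrow> nat \<Rightarrow> nat \<Rightarrow> real \<Rightarrow> tgraph \<Rightarrow> real" where
  "Lyapunov N m i \<kappa> g = (\<Sum>j=1..N. 2 * m / real (type_degree g j) - ln (N * type_share g j)) +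
     \<kappa> * ((type_discrepancy m i g)\<^sup>2 + m / (2 * real (total_degree g)))"

text \<open>
  An increment of at most \<open>c\<close> changes the compensated logarithm \<open>c / d - ln d\<close> by no more than its
  first-order term.
\<close>

lemma log_increment_bound:
  fixes c d \<delta> :: real
  assumes "0 < d" "0 \<le> \<delta>" "\<delta> \<le> c"
  shows "c / (d + \<delta>) - ln (d + \<delta>) \<le> c / d - ln d - \<delta> / d"
proof -
  have "ln d - ln (d + \<delta>) \<le> (d - (d + \<delta>)) / (d + \<delta>)"
    using assms by (intro ln_diff_le) auto
  moreover have "(c - \<delta>) / (d + \<delta>) \<le> (c - \<delta>) / d"
    using assms by (intro divide_left_mono) auto
  ultimately show ?thesis by (simp add: diff_divide_distrib)
qed

text \<open>
  If \<open>Z\<close> has an increment with absolute value at most \<open>m\<close> and mean \<open>e\<close> while \<open>D\<close> increases by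
  \<open>2 * m\<close>, the left-hand side bounds the expected change of \<open>(Z / D)\<^sup>2 + m / (2 * D)\<close>. The growth
  of \<open>D\<close> contracts \<open>Z / D\<close> towards \<open>0\<close>.
\<close>

lemma square_increment_bound:
  fixes D m Z e :: real
  assumes D: "0 < D" and m: "0 < m"
  shows "((Z\<^sup>2 + m\<^sup>2) / (D + 2 * m)\<^sup>2 - (Z / D)\<^sup>2 + m / (2 * (D + 2 * m)) - m / (2 * D)) + 2 * Z / (D + 2 * m)\<^sup>2 * e
    \<le> e\<^sup>2 / (m * D) - 2 * m / (D + 2 * m) * (Z / D)\<^sup>2"
proof -
  define E where "E = D + 2 * m"
  have E: "0 < E" "D \<le> E" using assms by (auto simp: E_def)
  have mE: "m = (E - D) / 2" by (simp add: E_def)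
  have 1: "m\<^sup>2 / E\<^sup>2 + m / (2 * E) - m / (2 * D) \<le> 0"
  proof -
    have "m / (2 * E) - m / (2 * D) = - (m\<^sup>2 / (D * E))"
      using D E unfolding mE by (simp add: field_simps power2_eq_square)
    moreover have "m\<^sup>2 / E\<^sup>2 \<le> m\<^sup>2 / (D * E)"
      using D E by (intro divide_left_mono) (auto simp: power2_eq_square)
    ultimately show ?thesis by linarith
  qed
  \<comment> \<open>The weights in this instance of Young's inequality are such that the factor \<open>1 + m / D\<close> of
     \<open>Z\<^sup>2\<close> is outweighed by the growth of the denominator.\<close>
  have 2: "2 * Z * e \<le> m * Z\<^sup>2 / D + e\<^sup>2 * D / m"
  proof -
    have "m * Z\<^sup>2 / D + e\<^sup>2 * D / m - 2 * Z * e = (m * Z - e * D)\<^sup>2 / (m * D)"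
      using D m by (simp add: field_simps power2_eq_square)
    also have "0 \<le> \<dots>" using D m by simp
    finally show ?thesis by linarith
  qed
  have "(Z\<^sup>2 + 2 * Z * e) / E\<^sup>2 \<le> (Z\<^sup>2 + (m * Z\<^sup>2 / D + e\<^sup>2 * D / m)) / E\<^sup>2"
    using 2 by (intro divide_right_mono) auto
  also have "\<dots> = Z\<^sup>2 / D * ((D + m) / E\<^sup>2) + e\<^sup>2 / m * (D / E\<^sup>2)"
  proof -
    have *: "(Z\<^sup>2 + (m * Z\<^sup>2 / D + e\<^sup>2 * D / m)) = Z\<^sup>2 / D * (D + m) + e\<^sup>2 / m * D"
      using D by (simp add: field_simps)
    show ?thesis
      unfolding * add_divide_distrib[of "Z\<^sup>2 / D * (D + m)"] by simp
  qed
  also have "\<dots> \<le> Z\<^sup>2 / D * (1 / E) + e\<^sup>2 / m * (1 / D)"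
  proof (intro add_mono mult_left_mono)
    have "(D + m) / E\<^sup>2 \<le> E / E\<^sup>2"
      using m by (intro divide_right_mono) (auto simp: E_def)
    then show "(D + m) / E\<^sup>2 \<le> 1 / E"
      using E by (simp add: power2_eq_square)
    have "D * D \<le> E * E" using D E by (intro mult_mono) auto
    then show "D / E\<^sup>2 \<le> 1 / D"
      using D E by (simp add: field_simps power2_eq_square)
  qed (use D m in auto)
  also have "Z\<^sup>2 / D * (1 / E) = (Z / D)\<^sup>2 - 2 * m / E * (Z / D)\<^sup>2"
    using D E unfolding mE by (simp add: field_simps power2_eq_square)
  finally have "(Z\<^sup>2 + 2 * Z * e) / E\<^sup>2 \<le> (Z / D)\<^sup>2 - 2 * m / E * (Z / D)\<^sup>2 + e\<^sup>2 / (m * D)"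
    by simp
  with 1 show ?thesis
    unfolding E_def[symmetric] by (simp add: add_divide_distrib)
qed

lemma Lyapunov_add_vertex_le:
  assumes g: "all_types_present N g" and N: "1 \<le> N" and m: "1 \<le> m" and i: "i \<in> {1..N}" and \<kappa>: "0 \<le> \<kappa>"
    and vs: "set vs \<subseteq> verts g" "length vs = m"
  defines "D \<equiv> real (total_degree g)"
  defines "Z \<equiv> real (type_degree g i) - 2 * m * real (type_count g i)"
  defines "w \<equiv> map (type_of g) vs"
  shows "Lyapunov N m i \<kappa> (add_vertex g t vs) \<le> Lyapunov N m i \<kappa> g
    + (\<Sum>j=1..N. 2 * m / D - 1 / type_degree g j * (real (count_list w j) + real m * of_bool (t = j)))
    + (\<kappa> * ((Z\<^sup>2 + (real m)\<^sup>2) / (D + 2 * m)\<^sup>2 - (Z / D)\<^sup>2 + m / (2 * (D + 2 * m)) - m / (2 * D))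
      + \<kappa> * (2 * Z / (D + 2 * m)\<^sup>2) * (real (count_list w i) - real m * of_bool (t = i)))"
proof -
  let ?g = "add_vertex g t vs"
  have tg: "typed_graph N g" using g by (simp add: all_types_present_def)
  have D: "0 < D" using total_degree_pos[OF g N] by (simp add: D_def)
  have D': "real (total_degree ?g) = D + 2 * m"
    using total_degree_add_vertex[OF tg vs(1)] vs by (simp add: D_def)
  define \<delta> where "\<delta> j = real (count_list w j) + real m * of_bool (t = j)" for j
  have d: "real (type_degree ?g j) = type_degree g j + \<delta> j" for j
    using type_degree_add_vertex[OF tg vs(1)] vs by (simp add: \<delta>_def w_def)
  have \<delta>: "0 \<le> \<delta> j" "\<delta> j \<le> 2 * m" for j
    using count_le_length[of w j] vs by (auto simp: \<delta>_def w_def)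
  have log: "2 * m / real (type_degree ?g j) - ln (N * type_share ?g j) \<le>
      (2 * m / real (type_degree g j) - ln (N * type_share g j)) + (2 * m / D - 1 / type_degree g j * \<delta> j)"
    if j: "j \<in> {1..N}" for j
  proof -
    have dj: "0 < real (type_degree g j)" using g j by (simp add: all_types_present_def)
    have "ln (N * type_share ?g j) = ln N + ln (type_degree g j + \<delta> j) - ln (D + 2 * m)"
      unfolding type_share_def D' d using N D dj \<delta>[of j] by (simp add: ln_mult ln_div)
    moreover have "ln (N * type_share g j) = ln N + ln (type_degree g j) - ln D"
      unfolding type_share_def using N D dj by (simp add: ln_mult ln_div D_def)
    moreover have "ln (D + 2 * m) - ln D \<le> (D + 2 * m - D) / D"
      using D by (intro ln_diff_le) auto
    moreover have "2 * m / (type_degree g j + \<delta> j) - ln (type_degree g j + \<delta> j)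
        \<le> 2 * m / type_degree g j - ln (type_degree g j) - \<delta> j / type_degree g j"
      using log_increment_bound[OF dj \<delta>] by simp
    ultimately show ?thesis unfolding d by simp
  qed
  define e where "e = real (count_list w i) - real m * of_bool (t = i)"
  have Z': "real (type_degree ?g i) - 2 * m * real (type_count ?g i) = Z + e"
    by (simp add: d \<delta>_def type_count_add_vertex Z_def e_def algebra_simps)
  have disc: "type_discrepancy m i ?g = (Z + e) / (D + 2 * m)"
    using Z' D' by (simp add: type_discrepancy_def)
  have "\<bar>e\<bar> \<le> m"
    using count_le_length[of w i] vs by (auto simp: e_def w_def)
  then have "e\<^sup>2 \<le> (real m)\<^sup>2"
    by (simp add: abs_le_square_iff[symmetric])
  then have "(Z + e)\<^sup>2 / (D + 2 * m)\<^sup>2 \<le> (Z\<^sup>2 + (real m)\<^sup>2 + 2 * Z * e) / (D + 2 * m)\<^sup>2"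
  proof (intro divide_right_mono)
    show "(Z + e)\<^sup>2 \<le> Z\<^sup>2 + (real m)\<^sup>2 + 2 * Z * e"
      using \<open>e\<^sup>2 \<le> (real m)\<^sup>2\<close> by (simp add: power2_sum)
  qed simp
  then have "(type_discrepancy m i ?g)\<^sup>2 \<le> (Z\<^sup>2 + (real m)\<^sup>2) / (D + 2 * m)\<^sup>2 + 2 * Z / (D + 2 * m)\<^sup>2 * e"
    by (simp only: disc power_divide) (simp add: add_divide_distrib)
  then have "(type_discrepancy m i ?g)\<^sup>2 + m / (2 * real (total_degree ?g)) \<le>
      ((type_discrepancy m i g)\<^sup>2 + m / (2 * real (total_degree g))) +
      (((Z\<^sup>2 + (real m)\<^sup>2) / (D + 2 * m)\<^sup>2 - (Z / D)\<^sup>2 + m / (2 * (D + 2 * m)) - m / (2 * D))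
      + 2 * Z / (D + 2 * m)\<^sup>2 * e)"
    unfolding D' by (simp add: type_discrepancy_def Z_def D_def)
  from mult_left_mono[OF this \<kappa>]
  have quad: "\<kappa> * ((type_discrepancy m i ?g)\<^sup>2 + m / (2 * real (total_degree ?g))) \<le>
      \<kappa> * ((type_discrepancy m i g)\<^sup>2 + m / (2 * real (total_degree g))) +
      (\<kappa> * ((Z\<^sup>2 + (real m)\<^sup>2) / (D + 2 * m)\<^sup>2 - (Z / D)\<^sup>2 + m / (2 * (D + 2 * m)) - m / (2 * D))
      + \<kappa> * (2 * Z / (D + 2 * m)\<^sup>2) * e)"
    unfolding distrib_left[of \<kappa>] mult.assoc[of \<kappa>] .
  have "(\<Sum>j=1..N. 2 * m / real (type_degree ?g j) - ln (N * type_share ?g j)) \<le>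
      (\<Sum>j=1..N. 2 * m / real (type_degree g j) - ln (N * type_share g j)) +
      (\<Sum>j=1..N. 2 * m / D - 1 / type_degree g j * \<delta> j)"
    unfolding sum.distrib[symmetric] by (intro sum_mono log)
  with quad show ?thesis
    unfolding Lyapunov_def \<delta>_def[symmetric] e_def[symmetric] of_nat_mult of_nat_numeral by linarith
qed

lemma Lyapunov_drift:
  assumes g: "all_types_present N g" and N: "1 \<le> N" and m: "3 \<le> m" and i: "i \<in> {1..N}" and \<kappa>: "0 \<le> \<kappa>"
  defines "D \<equiv> real (total_degree g)" and "p \<equiv> adopt_prob {1..N} m (type_share g)"
  shows "measure_pmf.expectation (pa_step m g) (Lyapunov N m i \<kappa>) \<le> Lyapunov N m i \<kappa> g
    - m / D * (\<Sum>j=1..N. (p j - type_share g j) / type_share g j)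
    + \<kappa> * ((m * (type_share g i - p i))\<^sup>2 / (m * D) - 2 * m / (D + 2 * m) * (type_discrepancy m i g)\<^sup>2)"
proof -
  define Z where "Z = real (type_degree g i) - 2 * m * real (type_count g i)"
  define x where "x = type_share g"
  let ?E = "step_mean {1..N} m x"
  have D: "0 < D" using total_degree_pos[OF g N] by (simp add: D_def)
  have m1: "1 \<le> m" using m by simp
  have x1: "sum x {1..N} = 1" unfolding x_def by (rule sum_type_share[OF g N])
  have dj: "real (type_degree g j) = D * x j" for j
    using D by (simp add: x_def type_share_def D_def)
  define A where "A = \<kappa> * ((Z\<^sup>2 + (real m)\<^sup>2) / (D + 2 * m)\<^sup>2 - (Z / D)\<^sup>2 + m / (2 * (D + 2 * m)) - m / (2 * D))"
  define B where "B = \<kappa> * (2 * Z / (D + 2 * m)\<^sup>2)"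
  have "measure_pmf.expectation (pa_step m g) (Lyapunov N m i \<kappa>) \<le>
    ?E (\<lambda>w t. Lyapunov N m i \<kappa> g
      + (\<Sum>j=1..N. 2 * m / D - 1 / type_degree g j * (real (count_list w j) + real m * of_bool (t = j)))
      + (A + B * (real (count_list w i) - real m * of_bool (t = i))))"
    unfolding x_def
  proof (rule expectation_pa_step_le[OF g N m1])
    fix vs t assume "set vs \<subseteq> verts g" "length vs = m"
    from Lyapunov_add_vertex_le[OF g N m1 i \<kappa> this, of t]
    show "Lyapunov N m i \<kappa> (add_vertex g t vs) \<le> Lyapunov N m i \<kappa> g
      + (\<Sum>j=1..N. 2 * m / D - 1 / type_degree g j *
          (real (count_list (map (type_of g) vs) j) + real m * of_bool (t = j)))
      + (A + B * (real (count_list (map (type_of g) vs) i) - real m * of_bool (t = i)))"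
      by (simp only: A_def B_def D_def Z_def of_nat_mult of_nat_numeral)
  qed
  also have "\<dots> = Lyapunov N m i \<kappa> g + (\<Sum>j=1..N. 2 * m / D - 1 / type_degree g j * (m * x j + m * p j))
      + (A + B * (m * x i - m * p i))"
    using i x1 m1
    by (simp only: step_mean_add step_mean_diff step_mean_sum step_mean_cmult step_mean_adopt
      step_mean_const[OF m1 _ x1] step_mean_count[OF m1 _ x1]
      finite_atLeastAtMost p_def x_def[symmetric] cong: sum.cong)
  also have "(\<Sum>j=1..N. 2 * m / D - 1 / type_degree g j * (m * x j + m * p j)) =
      - (m / D * (\<Sum>j=1..N. (p j - x j) / x j))"
    unfolding sum_distrib_left sum_negf[symmetric]
  proof (intro sum.cong refl)
    fix j assume "j \<in> {1..N}"
    then have "x j \<noteq> 0" using type_share_pos[OF g N] by (fastforce simp: x_def)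
    then show "2 * m / D - 1 / type_degree g j * (m * x j + m * p j) = - (m / D * ((p j - x j) / x j))"
      using D by (simp add: dj field_simps)
  qed
  also have "A + B * (m * x i - m * p i) \<le>
      \<kappa> * ((m * (x i - p i))\<^sup>2 / (m * D) - 2 * m / (D + 2 * m) * (Z / D)\<^sup>2)"
    using mult_left_mono[OF square_increment_bound[OF D, of "real m" Z "m * (x i - p i)"] \<kappa>] m1
    by (simp add: A_def B_def distrib_left right_diff_distrib mult.assoc)
  finally show ?thesis
    by (simp add: x_def type_discrepancy_def Z_def D_def)
qed

text \<open>
  For small \<open>\<kappa>\<close> the drift \<open>e\<^sup>2 / (m * D)\<close> that the discrepancy inherits from the shares is at most
  half of the decrease of the logarithmic part.
\<close>

lemma Lyapunov_decrement:
  assumes N: "1 \<le> N" and m: "3 \<le> m" and i: "i \<in> {1..N}"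
  obtains \<kappa> a where "0 < \<kappa>" "0 < a"
    "\<And>g. all_types_present N g \<Longrightarrow> measure_pmf.expectation (pa_step m g) (Lyapunov N m i \<kappa>) \<le>
      Lyapunov N m i \<kappa> g - a * (share_spread N g + (type_discrepancy m i g)\<^sup>2) / total_degree g"
proof -
  define c where "c = 1 / (8 * real m * real N ^ (m - 3))"
  define L where "L = (2 * real N * card (words {1..N} m) * (real m)\<^sup>2)\<^sup>2"
  define \<kappa> where "\<kappa> = (real m)\<^sup>2 * c / (2 * (L + 1))"
  define a where "a = min (m * c / 2) (2 * m * \<kappa> / (1 + 2 * m))"
  have c: "0 < c" using N m by (simp add: c_def)
  have L: "0 \<le> L" by (simp add: L_def)
  have \<kappa>: "0 < \<kappa>" using m c L by (simp add: \<kappa>_def)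
  have a: "0 < a" using m c \<kappa> by (simp add: a_def)
  have "\<kappa> * L \<le> (real m)\<^sup>2 * c / 2"
    using L c by (simp add: \<kappa>_def field_simps)
  then have \<kappa>L: "\<kappa> * L / m \<le> m * c / 2"
    using m by (simp add: field_simps power2_eq_square)
  show thesis
  proof (rule that[OF \<kappa> a])
    fix g assume g: "all_types_present N g"
    define D where "D = real (total_degree g)"
    define x where "x = type_share g"
    define p where "p = adopt_prob {1..N} m x"
    define s where "s = share_spread N g"
    define q where "q = (type_discrepancy m i g)\<^sup>2"
    have D: "1 \<le> D" using total_degree_pos[OF g N] by (simp add: D_def)
    have s: "0 \<le> s" by (simp add: s_def share_spread_def sum_nonneg)
    have q: "0 \<le> q" by (simp add: q_def)
    have xp: "0 < x k" if "k \<in> {1..N}" for k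
      using type_share_pos[OF g N that] by (simp add: x_def)
    have x1: "sum x {1..N} = 1" unfolding x_def by (rule sum_type_share[OF g N])
    have "c * s \<le> (\<Sum>j=1..N. (p j - x j) / x j)"
      using adopt_prob_drift[of "{1..N}" m x] m xp x1
      by (simp add: c_def s_def share_spread_def p_def x_def)
    then have 1: "m / D * (c * s) \<le> m / D * (\<Sum>j=1..N. (p j - x j) / x j)"
      using D by (intro mult_left_mono) auto
    have "(m * (x i - p i))\<^sup>2 \<le> L * s"
      using adopt_prob_Lipschitz[of "{1..N}" x i m] xp x1 i
      by (simp add: L_def s_def share_spread_def p_def x_def less_imp_le)
    then have "(m * (x i - p i))\<^sup>2 / (m * D) \<le> L * s / (m * D)"
      using D by (intro divide_right_mono) auto
    moreover have "2 * m / ((1 + 2 * m) * D) * q \<le> 2 * m / (D + 2 * m) * q"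
    proof (intro mult_right_mono divide_left_mono mult_pos_pos q)
      show "D + real (2 * m) \<le> real (1 + 2 * m) * D"
        using D m by (simp add: algebra_simps)
    qed (use D m in auto)
    ultimately have "(m * (x i - p i))\<^sup>2 / (m * D) - 2 * m / (D + 2 * m) * q \<le>
        L * s / (m * D) - 2 * m / ((1 + 2 * m) * D) * q"
      by linarith
    then have 2: "\<kappa> * ((m * (x i - p i))\<^sup>2 / (m * D) - 2 * m / (D + 2 * m) * q) \<le>
        \<kappa> * (L * s / (m * D) - 2 * m / ((1 + 2 * m) * D) * q)"
      using \<kappa> by (intro mult_left_mono) auto
    have "a * s \<le> m * c / 2 * s" by (rule mult_right_mono[OF _ s]) (simp add: a_def)
    moreover have "a * q \<le> 2 * m * \<kappa> / (1 + 2 * m) * q" by (rule mult_right_mono[OF _ q]) (simp add: a_def)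
    moreover have "\<kappa> * L / m * s \<le> m * c / 2 * s" by (rule mult_right_mono[OF \<kappa>L s])
    ultimately have "a * (s + q) \<le> m * (c * s) - \<kappa> * L / m * s + 2 * m * \<kappa> / (1 + 2 * m) * q"
      by (simp add: distrib_left)
    then have "a * (s + q) / D \<le> (m * (c * s) - \<kappa> * L / m * s + 2 * m * \<kappa> / (1 + 2 * m) * q) / D"
      using D by (intro divide_right_mono) auto
    also have "\<dots> = m / D * (c * s) - \<kappa> * (L * s / (m * D) - 2 * m / ((1 + 2 * m) * D) * q)"
      by (simp add: add_divide_distrib diff_divide_distrib right_diff_distrib mult.commute mult.left_commute)
    finally have "- (m / D * (c * s)) + \<kappa> * (L * s / (m * D) - 2 * m / ((1 + 2 * m) * D) * q) \<le> - (a * (s + q) / D)"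
      by linarith
    with 1 2 Lyapunov_drift[OF g N m i less_imp_le[OF \<kappa>]]
    show "measure_pmf.expectation (pa_step m g) (Lyapunov N m i \<kappa>) \<le>
      Lyapunov N m i \<kappa> g - a * (share_spread N g + (type_discrepancy m i g)\<^sup>2) / total_degree g"
      unfolding s_def q_def p_def x_def D_def of_nat_mult of_nat_numeral of_nat_add of_nat_1 by linarith
  qed
qed

text \<open>
  Applying \<open>ln z \<le> z - 1\<close> to \<open>z = sqrt y\<close> gives \<open>(sqrt y - 1)\<^sup>2 \<le> y - 1 - ln y\<close>; summing over
  \<open>y = N * x j\<close> cancels the linear terms because the shares add up to \<open>1\<close>.
\<close>

lemma sum_ln_share_bounds:
  assumes g: "all_types_present N g" and N: "1 \<le> N" and i: "i \<in> {1..N}"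
  shows "(sqrt (N * type_share g i) - 1)\<^sup>2 \<le> (\<Sum>j=1..N. - ln (N * type_share g j))"
proof -
  define y where "y j = N * type_share g j" for j
  have y: "0 < y j" if "j \<in> {1..N}" for j
    using type_share_pos[OF g N that] N by (simp add: y_def)
  have le: "(sqrt (y j) - 1)\<^sup>2 \<le> y j - 1 - ln (y j)" if "j \<in> {1..N}" for j
  proof -
    have "ln (y j) = 2 * ln (sqrt (y j))" using y[OF that] by (simp add: ln_sqrt)
    also have "ln (sqrt (y j)) \<le> sqrt (y j) - 1" using y[OF that] by (intro ln_le_minus_one) auto
    finally show ?thesis using y[OF that] by (simp add: power2_diff)
  qed
  have "(sqrt (y i) - 1)\<^sup>2 \<le> (\<Sum>j=1..N. (sqrt (y j) - 1)\<^sup>2)"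
    using i by (intro member_le_sum) auto
  also have "\<dots> \<le> (\<Sum>j=1..N. y j - 1 - ln (y j))"
    by (intro sum_mono le)
  also have "\<dots> = (\<Sum>j=1..N. - ln (y j)) + N * (\<Sum>j=1..N. type_share g j) - N"
    by (simp add: sum_subtractf sum_negf y_def sum_distrib_left)
  also have "\<dots> = (\<Sum>j=1..N. - ln (y j))"
    unfolding sum_type_share[OF g N] by simp
  finally show ?thesis
    by (simp add: y_def)
qed

lemma Lyapunov_bounds:
  assumes g: "all_types_present N g" and N: "1 \<le> N" and i: "i \<in> {1..N}" and \<kappa>: "0 < \<kappa>"
  shows "(sqrt (N * type_share g i) - 1)\<^sup>2 \<le> Lyapunov N m i \<kappa> g" (is "?s \<le> _")
    and "\<kappa> * (type_discrepancy m i g)\<^sup>2 \<le> Lyapunov N m i \<kappa> g" (is "?q \<le> _")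
    and "0 \<le> Lyapunov N m i \<kappa> g"
proof -
  have "0 \<le> (\<Sum>j=1..N. 2 * m / real (type_degree g j))" by (intro sum_nonneg) auto
  moreover have "0 \<le> \<kappa> * (m / (2 * real (total_degree g)))" using \<kappa> by simp
  ultimately have "?s + ?q \<le> Lyapunov N m i \<kappa> g"
    using sum_ln_share_bounds[OF g N i]
    by (simp add: Lyapunov_def sum_subtractf sum_negf distrib_left)
  moreover have "0 \<le> ?s" "0 \<le> ?q" using \<kappa> by simp_all
  ultimately show "?s \<le> Lyapunov N m i \<kappa> g" "?q \<le> Lyapunov N m i \<kappa> g" "0 \<le> Lyapunov N m i \<kappa> g"
    by linarith+
qed

section \<open>Almost sure convergence\<close>

text \<open>
  The sequence \<open>H\<close> cannot stay above \<open>e\<close>, because the harmonic series diverges.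
\<close>

lemma frequently_small:
  fixes H :: "nat \<Rightarrow> real" and c b :: real
  assumes H: "\<And>n. 0 \<le> H n" and sum: "summable (\<lambda>n. H n / (c + b * n))" and c: "0 < c" and b: "0 \<le> b"
    and e: "0 < e"
  shows "\<exists>n\<ge>n0. H n < e"
proof (rule ccontr)
  assume *: "\<not> (\<exists>n\<ge>n0. H n < e)"
  have "summable (\<lambda>n. (c + b) / e * (H n / (c + b * n)))"
    using sum by (rule summable_mult)
  then have "summable (\<lambda>n. 1 / real (Suc n))"
  proof (rule summable_comparison_test_ev[rotated], intro eventually_sequentiallyI)
    fix n assume "n0 \<le> n"
    then have "e \<le> H n" using * by (meson not_less)
    have "c + b * n \<le> (c + b) * Suc n" using c b by (simp add: algebra_simps)
    moreover have pos: "0 < c + b * n" using c b by (simp add: add_pos_nonneg)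
    ultimately have "1 / real (Suc n) \<le> (c + b) / (c + b * n)"
      by (simp add: field_simps)
    also have "\<dots> \<le> (c + b) / e * (H n / (c + b * n))"
    proof -
      have "(c + b) / (c + b * n) * 1 \<le> (c + b) / (c + b * n) * (H n / e)"
        using \<open>e \<le> H n\<close> e c b pos by (intro mult_left_mono) auto
      then show ?thesis by (simp add: mult.commute)
    qed
    finally show "norm (1 / real (Suc n)) \<le> (c + b) / e * (H n / (c + b * n))" by simp
  qed
  moreover have "\<not> summable (\<lambda>n. 1 / real (Suc n))"
    using not_summable_harmonic[where ?'a = real] summable_Suc_iff[of "\<lambda>n. inverse (real n)"]
    by (simp add: inverse_eq_divide)
  ultimately show False by blast
qed


lemma exists_small_Lyapunov:
  fixes g :: "nat \<Rightarrow> tgraph"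
  assumes N: "1 \<le> N" and g: "\<And>n. all_types_present N (g n)"
    and D: "\<And>n. total_degree (g n) = D0 + 2 * m * n" and m: "1 \<le> m"
    and sum: "summable (\<lambda>n. a * (share_spread N (g n) + (type_discrepancy m i (g n))\<^sup>2) / total_degree (g n))"
    and a: "0 < a" and e: "0 < e"
  shows "\<exists>n. Lyapunov N m i \<kappa> (g n) \<le> e"
proof -
  define H where "H n = share_spread N (g n) + (type_discrepancy m i (g n))\<^sup>2" for n
  have spread0: "0 \<le> share_spread N (g n)" for n by (simp add: share_spread_def sum_nonneg)
  then have H0: "0 \<le> H n" for n by (simp add: H_def)
  have D0: "0 < D0" using total_degree_pos[OF g N, of 0] by (simp add: D)
  have "summable (\<lambda>n. 1 / a * (a * H n / total_degree (g n)))"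
    using sum unfolding H_def by (rule summable_mult)
  then have "summable (\<lambda>n. H n / (real D0 + real (2 * m) * n))"
    using a by (simp add: D)
  then have "\<exists>n\<ge>k. H n < 1 / Suc k" for k
    using D0 by (intro frequently_small[where c = "real D0" and b = "real (2 * m)"] H0) auto
  then obtain r where r: "\<And>k. k \<le> r k" "\<And>k. H (r k) < 1 / Suc k" by metis
  have r_top: "filterlim r at_top sequentially"
    using r(1) by (intro filterlim_at_top_mono[OF filterlim_ident]) auto
  have H_lim: "(\<lambda>k. H (r k)) \<longlonglongrightarrow> 0"
  proof (rule tendsto_sandwich[OF _ _ tendsto_const])
    show "(\<lambda>k. 1 / real (Suc k)) \<longlonglongrightarrow> 0"
      using LIMSEQ_inverse_real_of_nat by (simp add: inverse_eq_divide)
  qed (use r(2) H0 in \<open>auto intro!: always_eventually less_imp_le\<close>)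
  have squeeze: "(\<lambda>k. f (g (r k))) \<longlonglongrightarrow> 0" if "\<And>n. (f (g n))\<^sup>2 \<le> H n" for f
  proof -
    have "(\<lambda>k. (f (g (r k)))\<^sup>2) \<longlonglongrightarrow> 0"
      by (rule tendsto_sandwich[OF _ _ tendsto_const H_lim]) (use that in auto)
    from tendsto_real_sqrt[OF this] show ?thesis
      by (simp add: tendsto_rabs_zero_iff)
  qed
  have Q: "(\<lambda>k. type_discrepancy m i (g (r k))) \<longlonglongrightarrow> 0"
    by (rule squeeze) (simp add: H_def spread0)
  have x: "(\<lambda>k. type_share (g (r k)) j) \<longlonglongrightarrow> 1 / N" if j: "j \<in> {1..N}" for j
  proof -
    have "(type_share (g n) j - 1 / N)\<^sup>2 \<le> H n" for n
    proof -
      have "(type_share (g n) j - 1 / N)\<^sup>2 \<le> share_spread N (g n)"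
        unfolding share_spread_def using j by (intro member_le_sum) auto
      then show ?thesis by (simp add: H_def add_increasing2)
    qed
    then have "(\<lambda>k. type_share (g (r k)) j - 1 / N) \<longlonglongrightarrow> 0"
      by (rule squeeze)
    then show ?thesis by (rule LIM_zero_cancel)
  qed
  have "filterlim (\<lambda>n. real (D0 + 2 * m * n)) at_top sequentially"
  proof (rule filterlim_at_top_mono[OF filterlim_real_sequentially])
    have "real n \<le> real (D0 + 2 * m * n)" for n
    proof -
      have "1 * n \<le> 2 * m * n" using m by (intro mult_right_mono) auto
      then show ?thesis by linarith
    qed
    then show "eventually (\<lambda>n. real n \<le> real (D0 + 2 * m * n)) sequentially" by simp
  qed
  then have "filterlim (\<lambda>n. real (total_degree (g n))) at_top sequentially"
    by (simp add: D)
  then have D_top: "filterlim (\<lambda>k. real (total_degree (g (r k)))) at_top sequentially"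
    by (rule filterlim_compose[OF _ r_top])
  have D_inv: "(\<lambda>k. inverse (real (total_degree (g (r k))))) \<longlonglongrightarrow> 0"
    by (rule tendsto_inverse_0_at_top[OF D_top])
  have summand: "(\<lambda>k. 2 * m / real (type_degree (g (r k)) j) - ln (N * type_share (g (r k)) j)) \<longlonglongrightarrow> 0"
    if j: "j \<in> {1..N}" for j
  proof -
    have eq: "2 * m / real (type_degree (g n) j) =
        2 * m * inverse (real (total_degree (g n))) / type_share (g n) j" for n
      using total_degree_pos[OF g N, of n] by (simp add: type_share_def field_simps)
    have "(\<lambda>k. 2 * m * inverse (real (total_degree (g (r k)))) / type_share (g (r k)) j
        - ln (N * type_share (g (r k)) j)) \<longlonglongrightarrow> real (2 * m) * 0 / (1 / N) - ln (N * (1 / N))"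
      using N by (intro tendsto_diff tendsto_divide tendsto_ln tendsto_mult tendsto_const x[OF j] D_inv) auto
    moreover have "real (2 * m) * 0 / (1 / N) - ln (N * (1 / N)) = (0 :: real)"
      using N by simp
    ultimately show ?thesis
      unfolding eq by (simp only:)
  qed
  have *: "(\<lambda>k. (\<Sum>j=1..N. 2 * m / real (type_degree (g (r k)) j) - ln (N * type_share (g (r k)) j)) +
     \<kappa> * ((type_discrepancy m i (g (r k)))\<^sup>2 + m / 2 * inverse (real (total_degree (g (r k))))))
    \<longlonglongrightarrow> (\<Sum>j=1..N. 0) + \<kappa> * (0\<^sup>2 + m / 2 * 0)"
    by (intro tendsto_add tendsto_sum tendsto_mult tendsto_const tendsto_power Q summand D_inv) auto
  have "(\<lambda>k. Lyapunov N m i \<kappa> (g (r k))) \<longlonglongrightarrow> 0"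
  proof -
    have eq: "m / 2 * inverse (real (total_degree (g n))) = m / (2 * real (total_degree (g n)))" for n
      by (simp add: field_simps)
    have "(\<Sum>j=1..N. 0) + \<kappa> * (0\<^sup>2 + m / 2 * 0) = (0 :: real)"
      by simp
    with * show ?thesis
      unfolding Lyapunov_def eq by (simp only: of_nat_mult of_nat_numeral)
  qed
  then have "eventually (\<lambda>k. Lyapunov N m i \<kappa> (g (r k)) < e) sequentially"
    using e by (rule order_tendstoD)
  then obtain k where "Lyapunov N m i \<kappa> (g (r k)) < e"
    by (metis eventually_happens sequentially_bot)
  then show ?thesis by (auto intro: less_imp_le)
qed

lemma type_proportion_tendsto:
  fixes g :: "nat \<Rightarrow> tgraph"
  assumes N: "1 \<le> N" and g: "\<And>n. all_types_present N (g n)" and i: "i \<in> {1..N}"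
    and D: "\<And>n. total_degree (g n) = D0 + 2 * m * n" and m: "1 \<le> m"
    and V: "\<And>n. length (types (g n)) = V0 + n" and \<kappa>: "0 < \<kappa>"
    and lim: "(\<lambda>n. Lyapunov N m i \<kappa> (g n)) \<longlonglongrightarrow> 0"
  shows "(\<lambda>n. type_proportion (g n) i) \<longlonglongrightarrow> 1 / N"
proof -
  have D0: "0 < D0" using total_degree_pos[OF g N, of 0] by (simp add: D)
  note bounds = Lyapunov_bounds(1,2)[where m = m, OF g N i \<kappa>]
  have "(\<lambda>n. (sqrt (N * type_share (g n) i) - 1)\<^sup>2) \<longlonglongrightarrow> 0"
    by (rule tendsto_sandwich[OF _ _ tendsto_const lim]) (use bounds in auto)
  from tendsto_real_sqrt[OF this] have "(\<lambda>n. sqrt (N * type_share (g n) i) - 1) \<longlonglongrightarrow> 0"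
    by (simp add: tendsto_rabs_zero_iff)
  from tendsto_power[OF LIM_zero_cancel[OF this], of 2]
  have "(\<lambda>n. N * type_share (g n) i) \<longlonglongrightarrow> 1"
    using type_share_pos[OF g N i] N by (simp add: less_imp_le)
  from tendsto_divide[OF this tendsto_const[of "real N"]]
  have x: "(\<lambda>n. type_share (g n) i) \<longlonglongrightarrow> 1 / N"
    using N by simp
  have "(\<lambda>n. \<kappa> * (type_discrepancy m i (g n))\<^sup>2) \<longlonglongrightarrow> 0"
    by (rule tendsto_sandwich[OF _ _ tendsto_const lim]) (use bounds \<kappa> in auto)
  from tendsto_divide[OF this tendsto_const[of \<kappa>]]
  have "(\<lambda>n. (type_discrepancy m i (g n))\<^sup>2) \<longlonglongrightarrow> 0"
    using \<kappa> by simp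
  from tendsto_real_sqrt[OF this] have "(\<lambda>n. type_discrepancy m i (g n)) \<longlonglongrightarrow> 0"
    by (simp add: tendsto_rabs_zero_iff)
  \<comment> \<open>The difference of the share and the discrepancy is \<open>2 * m\<close> times the number of vertices of
     type \<open>i\<close>, over the total degree.\<close>
  from tendsto_diff[OF x this]
  have count: "(\<lambda>n. 2 * m * real (type_count (g n) i) / (D0 + 2 * m * n)) \<longlonglongrightarrow> 1 / N"
    by (simp add: type_share_def type_discrepancy_def D diff_divide_distrib)
  have "(\<lambda>n. (real D0 + 2 * real m * real n) / (2 * real m * (real V0 + real n))) \<longlonglongrightarrow> 1"
  proof -
    define c where "c = real D0 / (2 * real m) - real V0"
    have "(\<lambda>n. inverse (real V0 + real n)) \<longlonglongrightarrow> 0"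
      by (intro tendsto_inverse_0_at_top filterlim_tendsto_add_at_top[OF tendsto_const] filterlim_real_sequentially)
    then have "(\<lambda>n. 1 + c * inverse (real V0 + real n)) \<longlonglongrightarrow> 1 + c * 0"
      by (intro tendsto_intros)
    moreover have "eventually (\<lambda>n. 1 + c * inverse (real V0 + real n) =
        (real D0 + 2 * real m * real n) / (2 * real m * (real V0 + real n))) sequentially"
      using eventually_gt_at_top[of 0]
    proof eventually_elim
      case (elim n)
      have "real D0 + 2 * real m * real n = 2 * real m * (real V0 + real n) + 2 * real m * c"
        using m by (simp add: c_def field_simps)
      then show ?case
        using m elim by (simp add: add_divide_distrib inverse_eq_divide)
    qed
    ultimately show ?thesis
      by (auto dest: Lim_transform_eventually)
  qed
  from tendsto_mult[OF count this]
  have "(\<lambda>n. 2 * m * real (type_count (g n) i) / (D0 + 2 * m * n) *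
      ((real D0 + 2 * real m * real n) / (2 * real m * (real V0 + real n)))) \<longlonglongrightarrow> 1 / N"
    by simp
  moreover have "2 * m * real (type_count (g n) i) / (D0 + 2 * m * n) *
      ((real D0 + 2 * real m * real n) / (2 * real m * (real V0 + real n))) = type_proportion (g n) i" for n
  proof -
    have "real D0 + 2 * real m * real n \<noteq> 0" using D0 by (simp add: add_nonneg_eq_0_iff)
    then show ?thesis
      using m V[of n] by (simp add: type_proportion_def type_count_def verts_def)
  qed
  ultimately show ?thesis by simp
qed

theorem theorem9:
  fixes N m :: nat and M :: "'a measure" and G0 :: tgraph and G :: "nat \<Rightarrow> 'a \<Rightarrow> tgraph"
  assumes "N \<ge> 2" and "m \<ge> 3"
    and "typed_graph N G0"
    and "\<And>i. i \<in> {1..N} \<Longrightarrow> type_degree G0 i > 0"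
    and "pref_attachment M m G0 G"
    and "i \<in> {1..N}"
  shows "AE \<omega> in M. (\<lambda>n. type_proportion (G n \<omega>) i) \<longlonglongrightarrow> 1 / real N"
proof -
  interpret pref_attachment M m G0 G by fact
  interpret chain: countable_markov_chain M "pa_step m" G0 G
    by unfold_locales (fact measurable_G initial transition)+
  have N: "1 \<le> N" and m: "1 \<le> m" using assms by auto
  have G0: "all_types_present N G0"
    using assms by (simp add: all_types_present_def)
  obtain \<kappa> a where \<kappa>: "0 < \<kappa>" and a: "0 < a" and drift: "\<And>g. all_types_present N g \<Longrightarrow>
      measure_pmf.expectation (pa_step m g) (Lyapunov N m i \<kappa>) \<le>
      Lyapunov N m i \<kappa> g - a * (share_spread N g + (type_discrepancy m i g)\<^sup>2) / total_degree g"
    using Lyapunov_decrement[OF N assms(2,6)] by blast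
  note step = all_types_present_pa_step[OF _ N m]
  have fin: "finite (set_pmf (pa_step m g))" if "all_types_present N g" for g
    using finite_set_pmf_pa_step[OF total_degree_pos[OF that N] m] .
  have V0: "0 \<le> Lyapunov N m i \<kappa> g" if "all_types_present N g" for g
    using Lyapunov_bounds(3)[OF that N assms(6) \<kappa>] .
  have H0: "0 \<le> a * (share_spread N g + (type_discrepancy m i g)\<^sup>2) / total_degree g" for g
    using a by (simp add: share_spread_def sum_nonneg)
  have "AE \<omega> in M. G 0 \<omega> = G0 \<and> (\<forall>n. all_types_present N (G n \<omega>)) \<and>
      (\<forall>n. G (Suc n) \<omega> \<in> set_pmf (pa_step m (G n \<omega>)))"
  proof -
    have "AE \<omega> in M. \<forall>n. all_types_present N (G n \<omega>)"
      by (rule chain.AE_invariant) (use G0 step(1) in auto)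
    with initial chain.AE_step show ?thesis by eventually_elim blast
  qed
  then have growth: "AE \<omega> in M. \<forall>n. all_types_present N (G n \<omega>) \<and>
      total_degree (G n \<omega>) = total_degree G0 + 2 * m * n \<and>
      length (types (G n \<omega>)) = length (types G0) + n"
  proof eventually_elim
    case (elim \<omega>)
    have "total_degree (G n \<omega>) = total_degree G0 + 2 * m * n \<and> length (types (G n \<omega>)) = length (types G0) + n" for n
    proof (induction n)
      case (Suc n)
      then show ?case
        using step(2,3)[of "G n \<omega>" "G (Suc n) \<omega>"] elim by simp
    qed (use elim in simp)
    then show ?case using elim by blast
  qed
  have "AE \<omega> in M. summable (\<lambda>n. a * (share_spread N (G n \<omega>) +
      (type_discrepancy m i (G n \<omega>))\<^sup>2) / total_degree (G n \<omega>))"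
    by (rule chain.AE_summable_decrements[where I = "all_types_present N" and V = "Lyapunov N m i \<kappa>"])
      (use G0 step(1) fin V0 H0 drift in auto)
  with growth have small: "AE \<omega> in M. \<forall>e>0. \<exists>n. Lyapunov N m i \<kappa> (G n \<omega>) \<le> e"
  proof eventually_elim
    case (elim \<omega>)
    then show ?case
      using exists_small_Lyapunov[OF N _ _ m _ a, of "\<lambda>n. G n \<omega>" "total_degree G0" i] by blast
  qed
  have "AE \<omega> in M. (\<lambda>n. Lyapunov N m i \<kappa> (G n \<omega>)) \<longlonglongrightarrow> 0"
    by (rule chain.AE_Lyapunov_tendsto_0[where I = "all_types_present N" and V = "Lyapunov N m i \<kappa>"
      and D = "\<lambda>g. a * (share_spread N g + (type_discrepancy m i g)\<^sup>2) / total_degree g"])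
      (use G0 step(1) fin V0 H0 drift small in auto)
  with growth show ?thesis
  proof eventually_elim
    case (elim \<omega>)
    then show ?case
      using type_proportion_tendsto[OF N _ assms(6) _ m _ \<kappa>, of "\<lambda>n. G n \<omega>" "total_degree G0" "length (types G0)"]
      by blast
  qed
qed

end
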